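(* Let $\mathcal G$ be a connected, compact, finite quantum graph of total length $L$ with $|N|\ge0$ vertices of degree one with the Neumann condition and any number $|D|\ge0$ of vertices (of degree one) with the Dirichlet condition, and natural conditions at all other vertices. Assume that $\mathcal G$ is not a cycle. Let $\beta:=E-V+1\ge0$ be its first Betti number, where $E$ and $V$ are the numbers of edges and vertices. Then for all $k\ge2$ $$\lambda_k(\mathcal G)\ \ge\ \begin{cases}\left(k-\dfrac{|N|+\beta}{2}\right)^2\dfrac{\pi^2}{L^2} & \text{if } k\ge |N|+\beta,\\[10pt] \dfrac{k^2\pi^2}{4L^2} & \text{otherwise.}\end{cases}$$ If there is at least one vertex with the Dirichlet condition, then the assumption $k\ge2$ may be replaced by $k\ge1$.
   Context: A quantum graph here is a connected metric graph with finitely many edges of finite length (each edge $e$ identified with $[0,\ell_e]$), joined at finitely many vertices (loops and multiple edges allowed), without vertices of degree two (these can be suppressed by merging the two incident edges; the only exception is the cycle graph), equipped with the Laplacian $-u''$ on each edge. $L$ is the sum of the edge lengths. Natural conditions at a vertex mean continuity of $u$ and vanishing of the sum of the derivatives of $u$ (directed into the edges) over all incident edge ends; at a vertex of degree one this is the Neumann condition $u'=0$. The Dirichlet condition at a degree-one vertex is $u=0$. The eigenvalues are numbered, with multiplicity, starting from $1$: $0\le\lambda_1(\mathcal G)<\lambda_2(\mathcal G)\le\lambda_3(\mathcal G)\le\dots$, whether or not there are Dirichlet vertices. *)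

theory Defs
  imports
    "HOL-Analysis.Analysis"
    "HOL-Library.Function_Algebras"
    "Graph_Theory.Digraph_Component"
begin

text \<open>Pointwise scalar multiplication, so that \<open>dim\<close> applies to spaces of functions.\<close>

instantiation "fun" :: (type, real_vector) real_vector
begin

definition scaleR_fun :: "real \<Rightarrow> ('a \<Rightarrow> 'b) \<Rightarrow> 'a \<Rightarrow> 'b" where
  "scaleR_fun c f = (\<lambda>x. c *\<^sub>R f x)"

instance
  by standard (auto simp: scaleR_fun_def fun_eq_iff scaleR_add_right scaleR_add_left)

end

text \<open>
  The underlying combinatorial graph is a finite multigraph, represented by an arbitrarily
  oriented \<open>pre_digraph\<close>. The orientation only serves to identify the edge \<open>e\<close> with the
  interval from \<open>0\<close> (at \<open>tail G e\<close>) to \<open>len e\<close> (at \<open>head G e\<close>). The degree counts edge ends,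
  so a loop contributes two.
\<close>

definition degree :: "('v, 'e) pre_digraph \<Rightarrow> 'v \<Rightarrow> nat" where
  "degree G v = in_degree G v + out_degree G v"

text \<open>Among finite connected multigraphs with an edge, the 2-regular ones are exactly the cycles
  (including the single loop).\<close>

definition cycle_graph :: "('v, 'e) pre_digraph \<Rightarrow> bool" where
  "cycle_graph G \<longleftrightarrow> (\<forall>v\<in>verts G. degree G v = 2)"

text \<open>\<open>D\<close> is the set of Dirichlet vertices. The name \<open>connected\<close> is qualified because of the
  topological constant of the same name.\<close>

locale quantum_graph = fin_digraph G
  for G :: "('v, 'e) pre_digraph" and len :: "'e \<Rightarrow> real" and D :: "'v set" +
  assumes connected_graph: "Digraph_Component.connected G"
    and arcs_nonempty: "arcs G \<noteq> {}"
    and len_pos: "\<And>e. e \<in> arcs G \<Longrightarrow> len e > 0"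
    and Dirichlet_leaves: "D \<subseteq> {v \<in> verts G. degree G v = 1}"
    and no_degree_two: "(\<forall>v\<in>verts G. degree G v \<noteq> 2) \<or> cycle_graph G"

definition total_length :: "('v, 'e) pre_digraph \<Rightarrow> ('e \<Rightarrow> real) \<Rightarrow> real" where
  "total_length G len = (\<Sum>e\<in>arcs G. len e)"

definition Neumann_vertices :: "('v, 'e) pre_digraph \<Rightarrow> 'v set \<Rightarrow> 'v set" where
  "Neumann_vertices G D = {v \<in> verts G. degree G v = 1} - D"

definition betti :: "('v, 'e) pre_digraph \<Rightarrow> int" where
  "betti G = int (card (arcs G)) - int (card (verts G)) + 1"

text \<open>
  Solutions of \<open>- u'' = \<mu> u\<close> satisfying the vertex conditions. \<open>u e\<close> is the function on the edge
  \<open>e\<close>, \<open>u' e\<close> its derivative (one-sided at the end points) and \<open>f v\<close> the common value at the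
  vertex \<open>v\<close>. The derivative directed into the edge is \<open>u' e 0\<close> at the tail and
  \<open>- u' e (len e)\<close> at the head. For a Neumann vertex of degree one the balance of derivatives is
  just \<open>u' = 0\<close>. HOL functions being total, \<open>u\<close> is normalised to vanish off the graph, so that
  each function on the graph is represented exactly once.
\<close>

definition eigenspace ::
  "('v, 'e) pre_digraph \<Rightarrow> ('e \<Rightarrow> real) \<Rightarrow> 'v set \<Rightarrow> real \<Rightarrow> ('e \<Rightarrow> real \<Rightarrow> real) set" where
  "eigenspace G len D \<mu> =
    {u. (\<forall>e x. e \<notin> arcs G \<or> x \<notin> {0..len e} \<longrightarrow> u e x = 0) \<and>
      (\<exists>u' f.
        (\<forall>e\<in>arcs G. \<forall>x\<in>{0..len e}.
          (u e has_real_derivative u' e x) (at x within {0..len e}) \<and>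
          (u' e has_real_derivative - \<mu> * u e x) (at x within {0..len e})) \<and>
        (\<forall>e\<in>arcs G. u e 0 = f (tail G e) \<and> u e (len e) = f (head G e)) \<and>
        (\<forall>v\<in>verts G - D.
          (\<Sum>e\<in>out_arcs G v. u' e 0) + (\<Sum>e\<in>in_arcs G v. - u' e (len e)) = 0) \<and>
        (\<forall>v\<in>D. f v = 0))}"

text \<open>
  \<open>lam 1 \<le> lam 2 \<le> \<dots>\<close> is the list of all eigenvalues, each repeated according to its multiplicity,
  the dimension of its eigenspace (the value \<open>lam 0\<close> is irrelevant). A real \<open>\<mu>\<close> that is not an
  eigenvalue has the trivial eigenspace, of dimension \<open>0\<close>, and so does not occur; finiteness is
  stated because \<open>card\<close> is \<open>0\<close> on infinite sets.
\<close>

definition eigenvalue_numbering ::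
  "('v, 'e) pre_digraph \<Rightarrow> ('e \<Rightarrow> real) \<Rightarrow> 'v set \<Rightarrow> (nat \<Rightarrow> real) \<Rightarrow> bool" where
  "eigenvalue_numbering G len D lam \<longleftrightarrow>
    mono_on {1..} lam \<and>
    (\<forall>\<mu>. finite {k. 1 \<le> k \<and> lam k = \<mu>} \<and>
         card {k. 1 \<le> k \<and> lam k = \<mu>} = dim (eigenspace G len D \<mu>))"

end

theory Submission
  imports Defs
begin

text \<open>
  Write \<open>\<omega>\<^sup>2\<close> for the asserted lower bound. By the easy half of the
  min-max principle it suffices to find fewer than \<open>k\<close> points of the graph such that
  every \<open>C\<^sup>1\<close> function \<open>u\<close> vanishing there and on \<open>D\<close>
  satisfies \<open>\<integral> u'\<^sup>2 - \<omega>\<^sup>2 u\<^sup>2 \<ge> 0\<close>: the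
  eigenfunctions of \<open>lam 1, \<dots>, lam k\<close> have a nontrivial combination vanishing
  at these points, and if \<open>lam k < \<omega>\<^sup>2\<close> then the orthogonality of
  eigenfunctions makes the integral negative for it (\<open>eigenvalue_lower_bound\<close>).

  The points come from a greedy decomposition. In the first case let \<open>\<omega> = \<pi> /
  \<ell>\<close> with \<open>\<ell> = L / (k - (|N| + \<beta>) / 2)\<close>. Detaching edges from
  vertices of degree at least three opens the graph to a tree; each of the \<open>\<beta>\<close>
  detachments creates one new Neumann leaf, and it only enlarges the space of functions. As far as
  the lowest eigenvalue is concerned, a Neumann leaf is as good as a Dirichlet leaf at the end of
  an additional edge of length \<open>\<ell> / 2\<close>. So there is a tree of length \<open>L +
  (|N| + \<beta>) \<ell> / 2 = k \<ell>\<close> whose leaves are all Dirichlet. Move from the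
  leaves inwards and cut whenever the length collected is about to exceed \<open>\<ell>\<close>. A
  cut removes at least the length \<open>\<ell>\<close>, whence \<open>k - 1\<close> cuts leave
  pieces of length at most \<open>\<ell>\<close> with Dirichlet leaves only, and their lowest
  eigenvalues are at least \<open>\<pi>\<^sup>2 / \<ell>\<^sup>2\<close>. In the second case
  \<open>\<omega> = k \<pi> / (2 L)\<close>, the pieces have length at most \<open>L / k\<close>,
  and each of them has a Dirichlet point; for such a piece the lowest eigenvalue is at least
  \<open>(\<pi> / 2)\<^sup>2 / (L / k)\<^sup>2\<close>, whatever its other leaves are.

  The spectral estimates for the pieces are proved while the pieces are built. A part that hangs
  at the vertex \<open>v\<close> and has collected the angle \<open>\<theta>\<close> contributes
  at least \<open>\<omega> cot \<theta> u(v)\<^sup>2\<close> to \<open>\<integral> u'\<^sup>2 -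
  \<omega>\<^sup>2 u\<^sup>2\<close>. This is preserved along an edge because the cotangent solves
  a Riccati equation (\<open>Riccati_energy_bound\<close>), and at a junction because the
  cotangent is superadditive there (\<open>join_loads\<close>). The last junction ends with a
  nonnegative coefficient (\<open>join_last_loads\<close>). The induction over the edges that
  still have to be processed is \<open>exists_controlling_points\<close>; that there always is an
  edge to process next is a fact on finite multigraphs (\<open>exists_removable_edge\<close>).
\<close>

section \<open>Removing leaves and edges from connected multigraphs\<close>

definition crosses :: "('v, 'e) pre_digraph \<Rightarrow> 'e \<Rightarrow> 'v set \<Rightarrow> bool" where
  "crosses G e X \<longleftrightarrow> (tail G e \<in> X) \<noteq> (head G e \<in> X)"

text \<open>
  Connectedness of the subgraph with vertices \<open>W\<close> and edges \<open>A\<close>, by cuts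
  instead of walks: in this form it passes to a subgraph by comparing vertex sets.
\<close>

definition cut_connected :: "('v, 'e) pre_digraph \<Rightarrow> 'v set \<Rightarrow> 'e set \<Rightarrow> bool" where
  "cut_connected G W A \<longleftrightarrow>
     (\<forall>e\<in>A. tail G e \<in> W \<and> head G e \<in> W) \<and>
     (\<forall>X\<subseteq>W. X \<noteq> {} \<longrightarrow> X \<noteq> W \<longrightarrow> (\<exists>e\<in>A. crosses G e X))"

definition joins :: "('v, 'e) pre_digraph \<Rightarrow> 'e \<Rightarrow> 'v \<Rightarrow> 'v \<Rightarrow> bool" where
  "joins G e v w \<longleftrightarrow> (tail G e = v \<and> head G e = w) \<or> (tail G e = w \<and> head G e = v)"

definition subdegree :: "('v, 'e) pre_digraph \<Rightarrow> 'e set \<Rightarrow> 'v \<Rightarrow> nat" where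
  "subdegree G A v = card {e \<in> A. tail G e = v} + card {e \<in> A. head G e = v}"

lemma cut_connected_crossing:
  "\<lbrakk>cut_connected G W A; X \<subseteq> W; X \<noteq> {}; X \<noteq> W\<rbrakk> \<Longrightarrow> \<exists>e\<in>A. crosses G e X"
  by (simp add: cut_connected_def)

lemma joins_ends: "\<lbrakk>cut_connected G W A; e \<in> A; joins G e v w\<rbrakk> \<Longrightarrow> v \<in> W \<and> w \<in> W"
  by (auto simp: cut_connected_def joins_def)

lemma subdegree_remove:
  assumes "finite A" "e \<in> A"
  shows "subdegree G A v = subdegree G (A - {e}) v
    + (if tail G e = v then 1 else 0) + (if head G e = v then 1 else 0)"
proof -
  have c: "card {x \<in> A. P x} = card {x \<in> A - {e}. P x} + (if P e then 1 else 0)" for P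
  proof (cases "P e")
    case True
    then have "{x \<in> A. P x} = insert e {x \<in> A - {e}. P x}" using assms by auto
    then show ?thesis using assms True by simp
  next
    case False
    then have "{x \<in> A. P x} = {x \<in> A - {e}. P x}" by auto
    then show ?thesis using False by simp
  qed
  show ?thesis unfolding subdegree_def using c[of "\<lambda>x. tail G x = v"] c[of "\<lambda>x. head G x = v"] by simp
qed

lemma subdegree_pos_joins:
  assumes "subdegree G A v > 0"
  obtains e w where "e \<in> A" "joins G e v w"
proof -
  have "{e \<in> A. tail G e = v} \<noteq> {} \<or> {e \<in> A. head G e = v} \<noteq> {}"
    using assms unfolding subdegree_def by (metis add_0 card.empty less_irrefl)
  then show ?thesis using that by (auto simp: joins_def)
qed

lemma subdegree_zero:
  "\<lbrakk>finite A; subdegree G A v = 0; e \<in> A\<rbrakk> \<Longrightarrow> tail G e \<noteq> v \<and> head G e \<noteq> v"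
  using subdegree_remove[of A e G v] by auto

lemma subdegree_one_remove:
  assumes "finite A" "e \<in> A" "joins G e v w" "subdegree G A v = 1"
  shows "w \<noteq> v" "subdegree G (A - {e}) v = 0"
proof -
  define t h n where "t = tail G e" "h = head G e" "n = subdegree G (A - {e}) v"
  have "1 = n + (if t = v then 1 else 0) + (if h = v then 1 else 0)"
    using subdegree_remove[OF assms(1,2), of G v] assms(4) unfolding t_h_n_def by metis
  moreover have "t = v \<and> h = w \<or> t = w \<and> h = v" using assms(3) by (simp add: joins_def t_h_n_def)
  ultimately show "w \<noteq> v" "subdegree G (A - {e}) v = 0"
    unfolding t_h_n_def(3)[symmetric] by (auto split: if_splits)
qed

lemma cut_connected_subdegree_pos:
  assumes "cut_connected G W A" "v \<in> W" "finite A" "A \<noteq> {}"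
  shows "subdegree G A v > 0"
proof -
  obtain e where e: "e \<in> A" and inc: "tail G e = v \<or> head G e = v"
  proof (cases "W = {v}")
    case True
    then show ?thesis using assms that by (auto simp: cut_connected_def)
  next
    case False
    then show ?thesis
      using cut_connected_crossing[OF assms(1), of "{v}"] assms(2) that
      by (auto simp: crosses_def)
  qed
  show ?thesis using subdegree_remove[OF assms(3) e, of G v] inc by auto
qed

text \<open>
  A set of remaining vertices is cut by an edge other than the pendant one once the leaf is put on
  the same side as its neighbour.
\<close>

lemma cut_connected_remove_leaf:
  assumes con: "cut_connected G W A" and fin: "finite A" and e: "e \<in> A" "joins G e v w"
    and deg: "subdegree G A v = 1"
  shows "v \<noteq> w" "cut_connected G (W - {v}) (A - {e})"
    "\<And>z. z \<noteq> v \<Longrightarrow> z \<noteq> w \<Longrightarrow> subdegree G (A - {e}) z = subdegree G A z"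
proof -
  note rem = subdegree_remove[OF fin e(1)]
  show vw: "v \<noteq> w" using subdegree_one_remove(1)[OF fin e deg] by simp
  have z: "subdegree G (A - {e}) v = 0" by (rule subdegree_one_remove(2)[OF fin e deg])
  have none: "tail G x \<noteq> v \<and> head G x \<noteq> v" if "x \<in> A" "x \<noteq> e" for x
    using subdegree_zero[OF finite_Diff[OF fin] z] that by simp
  show "cut_connected G (W - {v}) (A - {e})"
    unfolding cut_connected_def
  proof (intro conjI allI impI)
    show "\<forall>x\<in>A - {e}. tail G x \<in> W - {v} \<and> head G x \<in> W - {v}"
      using con none by (auto simp: cut_connected_def)
  next
    fix X assume X: "X \<subseteq> W - {v}" "X \<noteq> {}" "X \<noteq> W - {v}"
    have vW: "v \<in> W" using joins_ends[OF con e] by simp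
    define Y where "Y = (if w \<in> X then insert v X else X)"
    have "Y \<subseteq> W" "Y \<noteq> {}" "Y \<noteq> W" using X vW by (auto simp: Y_def)
    then obtain x where x: "x \<in> A" "crosses G x Y" using cut_connected_crossing[OF con] by blast
    have "x \<noteq> e" using x(2) e(2) X(1) by (auto simp: crosses_def joins_def Y_def split: if_splits)
    moreover have "crosses G x X"
      using x none[OF x(1) \<open>x \<noteq> e\<close>] by (auto simp: crosses_def Y_def split: if_splits)
    ultimately show "\<exists>e\<in>A - {e}. crosses G e X" using x(1) by blast
  qed
  show "subdegree G (A - {e}) z = subdegree G A z" if "z \<noteq> v" "z \<noteq> w" for z
    using rem[of G z] that e(2) by (auto simp: joins_def)
qed

definition only_crossing :: "('v, 'e) pre_digraph \<Rightarrow> 'e set \<Rightarrow> 'e \<Rightarrow> 'v set \<Rightarrow> bool" where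
  "only_crossing G A e X \<longleftrightarrow> {x \<in> A. crosses G x X} = {e}"

lemma bridge_only_crossing:
  assumes "cut_connected G W A" "e \<in> A" "\<not> cut_connected G W (A - {e})"
  obtains X where "X \<subseteq> W" "only_crossing G A e X"
proof -
  obtain X where X: "X \<subseteq> W" "X \<noteq> {}" "X \<noteq> W" "\<not> (\<exists>x\<in>A - {e}. crosses G x X)"
    using assms by (auto simp: cut_connected_def)
  moreover obtain x where "x \<in> A" "crosses G x X" using cut_connected_crossing[OF assms(1)] X by blast
  ultimately have "only_crossing G A e X" unfolding only_crossing_def by fast
  then show thesis using that X by blast
qed

lemma crosses_Diff:
  "\<lbrakk>tail G e \<in> W; head G e \<in> W; X \<subseteq> W\<rbrakk> \<Longrightarrow> crosses G e (W - X) \<longleftrightarrow> crosses G e X"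
  by (auto simp: crosses_def)

lemma only_crossing_Diff:
  assumes "cut_connected G W A" "X \<subseteq> W" "only_crossing G A e X"
  shows "only_crossing G A e (W - X)"
proof -
  have "{x \<in> A. crosses G x (W - X)} = {x \<in> A. crosses G x X}"
    using assms by (auto simp: cut_connected_def crosses_Diff)
  then show ?thesis using assms(3) by (simp add: only_crossing_def)
qed

text \<open>
  In a connected multigraph without leaves, with at least one vertex in a set \<open>Z\<close>
  containing all vertices of degree above two, some edge at a vertex of \<open>Z\<close> is not a
  bridge. Otherwise choose a set \<open>X\<close>, as small as possible, that only one edge
  \<open>e\<close> leaves, and let \<open>a \<in> X\<close> be an end of \<open>e\<close>. There
  is another edge \<open>f\<close> at \<open>a\<close>, with both ends in \<open>X\<close>. If
  \<open>a \<in> Z\<close> then \<open>f\<close> is a bridge, and intersecting \<open>X\<close>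
  with the side of \<open>f\<close> that avoids \<open>a\<close> gives a smaller set; if \<open>a
  \<notin> Z\<close> then \<open>a\<close> has degree two, and \<open>f\<close> is the only edge
  that leaves \<open>X - {a}\<close>.
\<close>

lemma exists_removable_edge:
  assumes con: "cut_connected G W A" and fin: "finite A" "finite W"
    and deg: "\<And>v. v \<in> W \<Longrightarrow> subdegree G A v \<ge> 2"
    and Z: "\<And>v. v \<in> W - Z \<Longrightarrow> subdegree G A v \<le> 2" "z \<in> W" "z \<in> Z"
  shows "\<exists>e\<in>A. \<exists>y\<in>Z. \<exists>w. joins G e y w \<and> cut_connected G W (A - {e})"
proof (rule ccontr)
  assume neg: "\<not> ?thesis"
  have bridge: "\<exists>X\<subseteq>W. only_crossing G A e X" if "e \<in> A" "joins G e y w" "y \<in> Z" for e y w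
  proof -
    have "\<not> cut_connected G W (A - {e})" using neg that by blast
    then show ?thesis using bridge_only_crossing[OF con that(1)] by metis
  qed
  define \<X> where "\<X> = {X. X \<subseteq> W \<and> (\<exists>e\<in>A. only_crossing G A e X)}"
  have \<X>I: "\<lbrakk>Y \<subseteq> W; f \<in> A; only_crossing G A f Y\<rbrakk> \<Longrightarrow> Y \<in> \<X>" for Y f
    by (auto simp: \<X>_def)
  have "subdegree G A z > 0" using deg[OF Z(2)] by simp
  then obtain e0 w0 where e0: "e0 \<in> A" "joins G e0 z w0" by (rule subdegree_pos_joins)
  obtain X0 where "X0 \<subseteq> W" "only_crossing G A e0 X0" using bridge[OF e0 Z(3)] by blast
  then have "X0 \<in> \<X>" using e0(1) unfolding \<X>_def by blast
  then obtain X where X: "X \<in> \<X>" and min: "\<And>Y. Y \<in> \<X> \<Longrightarrow> card X \<le> card Y"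
    using ex_has_least_nat[of "\<lambda>X. X \<in> \<X>" X0 card] by blast
  from X obtain e where XW: "X \<subseteq> W" and e: "e \<in> A" and only: "only_crossing G A e X"
    unfolding \<X>_def by blast
  have finX: "finite X" using XW fin(2) finite_subset by blast
  have smaller: False if "Y \<in> \<X>" "Y \<subset> X" for Y
    using min[OF that(1)] psubset_card_mono[OF finX that(2)] by simp
  have other: "\<not> crosses G x X" if "x \<in> A" "x \<noteq> e" for x
    using only that unfolding only_crossing_def by blast
  have "crosses G e X" using only unfolding only_crossing_def by blast
  then obtain a b where ab: "joins G e a b" "a \<in> X" "b \<notin> X"
    unfolding crosses_def joins_def by blast
  have aW: "a \<in> W" using ab XW by blast
  have "subdegree G (A - {e}) a > 0"
    using subdegree_remove[OF fin(1) e, of G a] deg[OF aW] ab by (auto simp: joins_def split: if_splits)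
  then obtain f c where f: "f \<in> A" "f \<noteq> e" "joins G f a c" by (rule subdegree_pos_joins) auto
  have cX: "c \<in> X" using other[OF f(1,2)] f(3) ab(2) by (auto simp: crosses_def joins_def)
  show False
  proof (cases "a \<in> Z")
    case True
    then obtain Y0 where Y0: "Y0 \<subseteq> W" "only_crossing G A f Y0" using bridge[OF f(1,3) True] by blast
    have cr: "crosses G f Y0" using Y0(2) unfolding only_crossing_def by blast
    define Y where "Y = (if a \<in> Y0 then W - Y0 else Y0)"
    have Y: "Y \<subseteq> W" "only_crossing G A f Y" "a \<notin> Y"
      using Y0 only_crossing_Diff[OF con Y0] by (auto simp: Y_def)
    have crf: "crosses G f Y" using Y(2) unfolding only_crossing_def by blast
    then have cY: "c \<in> Y" using f(3) Y(3) by (auto simp: crosses_def joins_def)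
    have other': "\<not> crosses G x Y" if "x \<in> A" "x \<noteq> f" for x
      using Y(2) that unfolding only_crossing_def by blast
    have "b \<notin> Y" using other'[OF e f(2)[symmetric]] ab Y(3) by (auto simp: crosses_def joins_def)
    have "{x \<in> A. crosses G x (Y \<inter> X)} = {f}"
    proof -
      have "crosses G f (Y \<inter> X)" using f(3) cY cX Y(3) by (auto simp: crosses_def joins_def)
      moreover have "\<not> crosses G x (Y \<inter> X)" if "x \<in> A" "x \<noteq> f" for x
      proof (cases "x = e")
        case True
        then show ?thesis using ab(1) Y(3) \<open>b \<notin> Y\<close> by (auto simp: crosses_def joins_def)
      next
        case False
        then show ?thesis using other[OF that(1)] other'[OF that] by (auto simp: crosses_def)
      qed
      ultimately show ?thesis using f(1) by blast
    qed
    then have "Y \<inter> X \<in> \<X>" using XW f(1) \<X>I[of "Y \<inter> X" f] unfolding only_crossing_def by blast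
    moreover have "Y \<inter> X \<subset> X" using ab(2) Y(3) by blast
    ultimately show False by (rule smaller)
  next
    case False
    have two: "subdegree G A a = 2" using deg[OF aW] Z(1)[of a] aW False by force
    have fe: "f \<in> A - {e}" using f by simp
    have s: "subdegree G (A - {e}) a = 1"
      using subdegree_remove[OF fin(1) e, of G a] two ab by (auto simp: joins_def split: if_splits)
    have ca: "c \<noteq> a" and z: "subdegree G (A - {e} - {f}) a = 0"
      using subdegree_one_remove[OF finite_Diff[OF fin(1)] fe f(3) s] by blast+
    have none: "tail G x \<noteq> a \<and> head G x \<noteq> a" if "x \<in> A" "x \<noteq> e" "x \<noteq> f" for x
      using subdegree_zero[OF finite_Diff[OF finite_Diff[OF fin(1)]] z] that by simp
    have "{x \<in> A. crosses G x (X - {a})} = {f}"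
    proof -
      have "crosses G f (X - {a})" using f(3) cX ca by (auto simp: crosses_def joins_def)
      moreover have "\<not> crosses G x (X - {a})" if "x \<in> A" "x \<noteq> f" for x
      proof (cases "x = e")
        case True
        then show ?thesis using ab by (auto simp: crosses_def joins_def)
      next
        case False
        then show ?thesis using other[OF that(1)] none[OF that(1) _ that(2)] by (auto simp: crosses_def)
      qed
      ultimately show ?thesis using f(1) by blast
    qed
    then have "X - {a} \<in> \<X>" using XW f(1) \<X>I[of "X - {a}" f] unfolding only_crossing_def by blast
    moreover have "X - {a} \<subset> X" using ab(2) by blast
    ultimately show False by (rule smaller)
  qed
qed

lemma (in quantum_graph) cut_connected_graph: "cut_connected G (verts G) (arcs G)"
proof -
  have "\<exists>e\<in>arcs G. crosses G e X" if X: "X \<subseteq> verts G" "X \<noteq> {}" "X \<noteq> verts G" for X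
  proof (rule ccontr)
    assume neg: "\<not> ?thesis"
    obtain a b where ab: "a \<in> X" "b \<in> verts G" "b \<notin> X" using X by blast
    have "strongly_connected (mk_symmetric G)"
      using connected_graph by (simp add: Digraph_Component.connected_def)
    then have "reachable (mk_symmetric G) a b"
      using ab X by (auto simp: strongly_connected_def)
    then have "(a, b) \<in> rtrancl_on (verts G) (arcs_ends (mk_symmetric G))"
      by (simp add: reachable_def)
    moreover have "y \<in> X" if "(x, y) \<in> rtrancl_on (verts G) (arcs_ends (mk_symmetric G))" "x \<in> X" for x y
      using that
      by (induction rule: rtrancl_on.induct) (use neg in \<open>auto simp: parcs_mk_symmetric crosses_def\<close>)
    ultimately have "b \<in> X" using ab(1) by blast
    then show False using ab by simp
  qed
  then show ?thesis by (simp add: cut_connected_def)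
qed

lemma subdegree_arcs: "subdegree G (arcs G) v = degree G v"
  by (simp add: subdegree_def degree_def in_degree_def out_degree_def in_arcs_def out_arcs_def)

section \<open>The Riccati estimate on an interval\<close>

definition c1_on :: "real \<Rightarrow> real \<Rightarrow> (real \<Rightarrow> real) \<Rightarrow> (real \<Rightarrow> real) \<Rightarrow> bool" where
  "c1_on p q u u' \<longleftrightarrow>
     (\<forall>x\<in>{p..q}. (u has_real_derivative u' x) (at x within {p..q})) \<and> continuous_on {p..q} u'"

definition energy :: "real \<Rightarrow> real \<Rightarrow> real \<Rightarrow> (real \<Rightarrow> real) \<Rightarrow> (real \<Rightarrow> real) \<Rightarrow> real" where
  "energy \<omega> p q u u' = integral {p..q} (\<lambda>x. (u' x)\<^sup>2 - \<omega>\<^sup>2 * (u x)\<^sup>2)"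

lemma c1_on_continuous: "c1_on p q u u' \<Longrightarrow> continuous_on {p..q} u"
  unfolding c1_on_def by (auto intro: DERIV_continuous_on)

lemma c1_on_subinterval:
  assumes "c1_on p q u u'" "p \<le> p'" "q' \<le> q"
  shows "c1_on p' q' u u'"
proof -
  have sub: "{p'..q'} \<subseteq> {p..q}" using assms by auto
  show ?thesis unfolding c1_on_def
  proof (intro conjI ballI)
    fix x assume "x \<in> {p'..q'}"
    then have "(u has_real_derivative u' x) (at x within {p..q})"
      using assms(1) sub by (auto simp: c1_on_def)
    then show "(u has_real_derivative u' x) (at x within {p'..q'})" by (rule DERIV_subset[OF _ sub])
  next
    show "continuous_on {p'..q'} u'"
      using assms(1) continuous_on_subset[OF _ sub] by (auto simp: c1_on_def)
  qed
qed

lemma energy_split: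
  assumes "c1_on p q u u'" "p \<le> x" "x \<le> q"
  shows "energy \<omega> p q u u' = energy \<omega> p x u u' + energy \<omega> x q u u'"
proof -
  have "(\<lambda>x. (u' x)\<^sup>2 - \<omega>\<^sup>2 * (u x)\<^sup>2) integrable_on {p..q}"
    using assms(1) c1_on_continuous[OF assms(1)]
    by (intro integrable_continuous_real continuous_intros) (auto simp: c1_on_def)
  then show ?thesis unfolding energy_def
    by (rule Henstock_Kurzweil_Integration.integral_combine[OF assms(2,3), symmetric])
qed

lemma c1_on_reflect:
  assumes "c1_on 0 l u u'"
  shows "c1_on 0 l (\<lambda>x. u (l - x)) (\<lambda>x. - u' (l - x))"
proof -
  have im: "(\<lambda>x. l - x) ` {0..l} = {0..l}"
    by (auto simp: image_def intro!: bexI[of _ "l - _"])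
  have "((\<lambda>x. u (l - x)) has_real_derivative - u' (l - x)) (at x within {0..l})"
    if x: "x \<in> {0..l}" for x
  proof -
    have "(u has_real_derivative u' (l - x)) (at (l - x) within (\<lambda>x. l - x) ` {0..l})"
      using assms x unfolding im c1_on_def by auto
    moreover have "((\<lambda>x. l - x) has_real_derivative -1) (at x within {0..l})"
      by (auto intro!: derivative_eq_intros)
    ultimately have "((u \<circ> (\<lambda>x. l - x)) has_real_derivative u' (l - x) * (-1)) (at x within {0..l})"
      by (rule DERIV_image_chain)
    then show ?thesis by (simp add: o_def)
  qed
  moreover have "continuous_on {0..l} (\<lambda>x. - u' (l - x))"
  proof (intro continuous_intros)
    show "continuous_on {0..l} (\<lambda>x. u' (l - x))"
      by (rule continuous_on_compose2[of "{0..l}" u']) (use assms in \<open>auto simp: c1_on_def intro!: continuous_intros\<close>)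
  qed
  ultimately show ?thesis by (simp add: c1_on_def)
qed

lemma energy_reflect:
  assumes "c1_on 0 l u u'"
  shows "energy \<omega> 0 l (\<lambda>x. u (l - x)) (\<lambda>x. - u' (l - x)) = energy \<omega> 0 l u u'"
proof -
  define g where "g = (\<lambda>x. (u' x)\<^sup>2 - \<omega>\<^sup>2 * (u x)\<^sup>2)"
  have "continuous_on {0..l} g"
    unfolding g_def using assms c1_on_continuous[OF assms]
    by (intro continuous_intros) (auto simp: c1_on_def)
  then have "(g has_integral integral {0..l} g) {0..l}"
    by (intro integrable_integral integrable_continuous_real)
  then have "((\<lambda>x. g (- x)) has_integral integral {0..l} g) {-l..-0}"
    by (subst has_integral_reflect_real) simp
  then have "((\<lambda>x. g (- (x - l))) has_integral integral {0..l} g) {0..l}"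
    using has_integral_shift_Icc_real[of "\<lambda>x. g (- (x - l))" l "integral {0..l} g" "-l" 0] by (simp add: o_def)
  then have "integral {0..l} (\<lambda>x. g (l - x)) = integral {0..l} g"
    by (simp add: integral_unique)
  then show ?thesis by (simp add: energy_def g_def)
qed

text \<open>
  A simple zero of the sine is compensated by the square of a function that has a zero there. Since
  division by zero gives zero, the product also has the right value, zero, at such a point.
\<close>

lemma tendsto_cot_times_square:
  fixes u :: "real \<Rightarrow> real"
  assumes u: "(u has_real_derivative u') (at z within S)" and z: "u z = 0 \<or> sin (c + \<omega> * z) \<noteq> 0"
    and \<omega>: "\<omega> \<noteq> 0"
  shows "((\<lambda>x. cot (c + \<omega> * x) * (u x)\<^sup>2) \<longlongrightarrow> cot (c + \<omega> * z) * (u z)\<^sup>2) (at z within S)"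
proof -
  have ucont: "(u \<longlongrightarrow> u z) (at z within S)"
    using DERIV_continuous[OF u] by (simp add: continuous_within)
  show ?thesis
  proof (cases "sin (c + \<omega> * z) = 0")
    case False
    have "((\<lambda>x. cos (c + \<omega> * x) / sin (c + \<omega> * x) * (u x)\<^sup>2) \<longlongrightarrow> cos (c + \<omega> * z) / sin (c + \<omega> * z) * (u z)\<^sup>2) (at z within S)"
      by (intro tendsto_intros ucont False)
    then show ?thesis by (simp add: cot_def)
  next
    case True
    then have uz: "u z = 0" using z by simp
    have c0: "cos (c + \<omega> * z) \<noteq> 0" using True sin_cos_squared_add[of "c + \<omega> * z"] by auto
    have d1: "((\<lambda>x. (u x - u z) / (x - z)) \<longlongrightarrow> u') (at z within S)"
      using u by (simp add: has_field_derivative_iff)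
    have "((\<lambda>x. sin (c + \<omega> * x)) has_real_derivative \<omega> * cos (c + \<omega> * z)) (at z within S)"
      by (auto intro!: derivative_eq_intros)
    then have d2: "((\<lambda>x. (sin (c + \<omega> * x) - sin (c + \<omega> * z)) / (x - z)) \<longlongrightarrow> \<omega> * cos (c + \<omega> * z)) (at z within S)"
      by (simp add: has_field_derivative_iff)
    define h where "h = (\<lambda>x. cos (c + \<omega> * x) * u x
      * (((u x - u z) / (x - z)) / ((sin (c + \<omega> * x) - sin (c + \<omega> * z)) / (x - z))))"
    have lim: "(h \<longlongrightarrow> cos (c + \<omega> * z) * u z * (u' / (\<omega> * cos (c + \<omega> * z)))) (at z within S)"
      unfolding h_def by (intro tendsto_intros ucont d1 d2) (use c0 \<omega> in auto)
    have "h x = cot (c + \<omega> * x) * (u x)\<^sup>2" if "x \<noteq> z" for x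
      using that by (simp add: h_def uz True cot_def power2_eq_square)
    then have "eventually (\<lambda>x. h x = cot (c + \<omega> * x) * (u x)\<^sup>2) (at z within S)"
      by (auto simp: eventually_at_filter)
    from Lim_transform_eventually[OF lim this] show ?thesis by (simp add: uz)
  qed
qed

lemma sin_pos_between:
  assumes "0 \<le> \<alpha>" "\<alpha> \<le> pi" "\<alpha> \<noteq> 0" "\<alpha> \<noteq> pi" shows "sin \<alpha> > 0"
  using assms by (intro sin_gt_zero) auto

text \<open>
  The function \<open>F x = \<omega> cot (\<alpha> + \<omega> (x - p)) u(x)\<^sup>2\<close>
  satisfies \<open>u'\<^sup>2 - \<omega>\<^sup>2 u\<^sup>2 - F' = (u' - \<omega> cot (\<dots>)
  u)\<^sup>2 \<ge> 0\<close>. The angle may start at \<open>0\<close> or end at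
  \<open>\<pi>\<close> if \<open>u\<close> vanishes there.
\<close>

lemma Riccati_energy_bound:
  assumes u: "c1_on p q u u'" and pq: "p \<le> q" and \<omega>: "\<omega> > 0"
    and \<alpha>: "0 \<le> \<alpha>" "\<alpha> + \<omega> * (q - p) \<le> pi"
    and up: "\<alpha> = 0 \<Longrightarrow> u p = 0" and uq: "\<alpha> + \<omega> * (q - p) = pi \<Longrightarrow> u q = 0"
  shows "\<omega> * cot (\<alpha> + \<omega> * (q - p)) * (u q)\<^sup>2 \<le> energy \<omega> p q u u' + \<omega> * cot \<alpha> * (u p)\<^sup>2"
proof -
  define c where "c = \<alpha> - \<omega> * p"
  define g where "g = (\<lambda>x. (u' x)\<^sup>2 - \<omega>\<^sup>2 * (u x)\<^sup>2)"
  define F where "F = (\<lambda>x. cot (c + \<omega> * x) * (u x)\<^sup>2)"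
  define J where "J = (\<lambda>x. integral {p..x} g - \<omega> * F x)"
  have gcont: "continuous_on {p..q} g"
    unfolding g_def using u c1_on_continuous[OF u]
    by (intro continuous_intros) (auto simp: c1_on_def)
  have ud: "(u has_real_derivative u' x) (at x within {p..q})" if "x \<in> {p..q}" for x
    using u that by (simp add: c1_on_def)
  have angle: "0 \<le> c + \<omega> * x" "c + \<omega> * x \<le> pi" "c + \<omega> * x = 0 \<Longrightarrow> x = p \<and> \<alpha> = 0"
      "c + \<omega> * x = pi \<Longrightarrow> x = q \<and> \<alpha> + \<omega> * (q - p) = pi" if "x \<in> {p..q}" for x
  proof -
    have 1: "c + \<omega> * x = \<alpha> + \<omega> * (x - p)" "c + \<omega> * x = \<alpha> + \<omega> * (q - p) - \<omega> * (q - x)"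
      by (auto simp: c_def algebra_simps)
    have 2: "\<omega> * (x - p) \<ge> 0" "\<omega> * (q - x) \<ge> 0" using that \<omega> by auto
    show "0 \<le> c + \<omega> * x" "c + \<omega> * x \<le> pi" using 1 2 \<alpha> by linarith+
    show "x = p \<and> \<alpha> = 0" if "c + \<omega> * x = 0"
    proof -
      have "\<omega> * (x - p) = 0" "\<alpha> = 0" using 1 2 \<alpha> that by linarith+
      then show ?thesis using \<omega> by simp
    qed
    show "x = q \<and> \<alpha> + \<omega> * (q - p) = pi" if "c + \<omega> * x = pi"
    proof -
      have "\<omega> * (q - x) = 0" "\<alpha> + \<omega> * (q - p) = pi" using 1 2 \<alpha> that by linarith+
      then show ?thesis using \<omega> by simp
    qed
  qed
  have Fcont: "continuous_on {p..q} F"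
    unfolding continuous_on_def F_def
  proof
    fix x assume x: "x \<in> {p..q}"
    have "u x = 0 \<or> sin (c + \<omega> * x) \<noteq> 0"
      using angle[OF x] up uq sin_pos_between[of "c + \<omega> * x"] by force
    then show "((\<lambda>x. cot (c + \<omega> * x) * (u x)\<^sup>2) \<longlongrightarrow> cot (c + \<omega> * x) * (u x)\<^sup>2) (at x within {p..q})"
      using tendsto_cot_times_square[OF ud[OF x]] \<omega> by simp
  qed
  have Jcont: "continuous_on {p..q} J"
    unfolding J_def
    by (intro continuous_intros Fcont indefinite_integral_continuous_1 integrable_continuous_real gcont)
  have "J p \<le> J q"
  proof (rule DERIV_nonneg_imp_increasing_open[OF pq _ Jcont])
    fix x assume x: "p < x" "x < q"
    then have xin: "x \<in> {p..q}" by simp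
    have at: "at x within {p..q} = at x" using x by (simp add: at_within_Icc_at)
    have s0: "sin (c + \<omega> * x) > 0"
      using angle[OF xin] x by (intro sin_pos_between) auto
    have d: "(u has_real_derivative u' x) (at x)" using ud[OF xin] at by simp
    define s k where "s = sin (c + \<omega> * x)" and "k = cot (c + \<omega> * x)"
    have "((\<lambda>x. cot (c + \<omega> * x)) has_real_derivative - inverse (s\<^sup>2) * \<omega>) (at x)"
      unfolding s_def using s0
      by (intro DERIV_chain2[of cot] DERIV_cot) (auto intro!: derivative_eq_intros)
    then have dF: "(F has_real_derivative (- inverse (s\<^sup>2) * \<omega> * (u x)\<^sup>2 + k * (2 * u x * u' x))) (at x)"
      unfolding F_def k_def using d by (auto intro!: derivative_eq_intros simp: algebra_simps)
    have dI: "((\<lambda>x. integral {p..x} g) has_real_derivative g x) (at x)"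
      using integral_has_real_derivative[OF gcont xin] at by simp
    have "(J has_real_derivative g x - \<omega> * (- inverse (s\<^sup>2) * \<omega> * (u x)\<^sup>2 + k * (2 * u x * u' x))) (at x)"
      unfolding J_def by (intro DERIV_diff dI DERIV_cmult dF)
    moreover have "inverse (s\<^sup>2) = 1 + k\<^sup>2"
      using s0 sin_cos_squared_add[of "c + \<omega> * x"]
      by (simp add: k_def s_def cot_def field_simps)
    then have "g x - \<omega> * (- inverse (s\<^sup>2) * \<omega> * (u x)\<^sup>2 + k * (2 * u x * u' x)) = (u' x - \<omega> * k * u x)\<^sup>2"
      by (simp add: g_def power2_eq_square algebra_simps)
    ultimately show "\<exists>y. (J has_real_derivative y) (at x) \<and> 0 \<le> y" by (metis zero_le_power2)
  qed
  moreover have "J p = - \<omega> * cot \<alpha> * (u p)\<^sup>2" by (simp add: J_def F_def c_def)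
  moreover have "J q = energy \<omega> p q u u' - \<omega> * cot (\<alpha> + \<omega> * (q - p)) * (u q)\<^sup>2"
    by (simp add: J_def F_def c_def energy_def g_def algebra_simps)
  ultimately show ?thesis by simp
qed

section \<open>Loads\<close>

lemma cot_add:
  fixes a b :: real
  assumes "sin a \<noteq> 0" "sin b \<noteq> 0"
  shows "cot a + cot b = sin (a + b) / (sin a * sin b)"
  using assms by (simp add: cot_def sin_add field_simps)

lemma cot_sum_nonneg:
  fixes a b :: real
  assumes "0 < a" "0 < b" "a + b \<le> pi"
  shows "0 \<le> cot a + cot b"
proof -
  have s: "sin a > 0" "sin b > 0" "sin (a + b) \<ge> 0"
    using assms by (auto intro!: sin_gt_zero sin_ge_zero)
  then show ?thesis using cot_add[of a b] by simp
qed

lemma cot_superadditive: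
  fixes a b :: real
  assumes "0 < a" "0 < b" "a + b < pi"
  shows "cot (a + b) \<le> cot a + cot b"
proof -
  have s: "sin a > 0" "sin b > 0" "sin (a + b) > 0"
    using assms by (auto intro!: sin_gt_zero)
  define c where "c = cos (a + b)"
  have "c * (sin a * sin b) = c * (cos (a - b) - c) / 2"
    by (simp add: c_def sin_times_sin)
  moreover have "c * cos (a - b) \<le> 1"
    using abs_cos_le_one[of "a + b"] abs_cos_le_one[of "a - b"]
    by (metis abs_ge_self abs_ge_zero abs_mult c_def mult_le_one order_trans)
  moreover have "c * c \<le> 1" using abs_square_le_1[of c] abs_cos_le_one[of "a + b"]
    by (simp add: c_def power2_eq_square)
  moreover have "(sin (a + b))\<^sup>2 = 1 - c * c"
    unfolding c_def sin_squared_eq by (simp only: power2_eq_square)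
  ultimately have "c * (sin a * sin b) \<le> (sin (a + b))\<^sup>2" by (simp add: algebra_simps)
  then have "c / sin (a + b) \<le> sin (a + b) / (sin a * sin b)"
    using s by (simp add: field_simps power2_eq_square)
  then show ?thesis using cot_add[of a b] s by (simp add: c_def cot_def)
qed

lemma cot_shift_superadditive:
  fixes a b :: real
  assumes "0 \<le> a" "0 \<le> b" "a + b < pi / 2"
  shows "cot (a + b + pi / 2) \<le> cot (a + pi / 2) + cot (b + pi / 2)"
proof -
  have ct: "cot (x + pi / 2) = - (sin x / cos x)" for x :: real
    by (simp add: cot_def sin_add cos_add)
  have c: "cos a > 0" "cos b > 0" "cos (a + b) > 0"
    using assms by (auto intro!: cos_gt_zero_pi)
  have s: "sin a \<ge> 0" "sin b \<ge> 0" "sin (a + b) \<ge> 0"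
    using assms by (auto intro!: sin_ge_zero)
  have "cos (a + b) \<le> cos a * cos b" using s by (simp add: cos_add)
  then have "sin (a + b) / (cos a * cos b) \<le> sin (a + b) / cos (a + b)"
    using s(3) c by (intro divide_left_mono) auto
  moreover have "sin (a + b) / (cos a * cos b) = sin a / cos a + sin b / cos b"
    using c by (simp add: sin_add field_simps)
  ultimately show ?thesis by (simp add: ct)
qed

text \<open>
  Superadditivity alone would give the angle \<open>a + b + \<pi> / 2\<close> on the left. The
  shift can be dropped because \<open>sin a \<le> cos b\<close>: a Dirichlet condition on one of
  two parts that meet improves the bound for both.
\<close>

lemma cot_mixed_superadditive:
  fixes a b :: real
  assumes "0 < a" "0 \<le> b" "a + b < pi / 2"
  shows "cot (a + b) \<le> cot a + cot (b + pi / 2)"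
proof -
  have ct: "cot (b + pi / 2) = - (sin b / cos b)"
    by (simp add: cot_def sin_add cos_add)
  have s: "sin a > 0" "sin (a + b) > 0" "cos b > 0" "sin b \<ge> 0"
    using assms by (auto intro!: sin_gt_zero sin_ge_zero cos_gt_zero_pi)
  have "sin a \<le> sin (pi / 2 - b)" using assms by (intro sin_monotone_2pi_le) auto
  then have "sin a \<le> cos b" by (simp add: sin_diff)
  then have "sin a * sin (a + b) \<le> cos b * 1" using s by (intro mult_mono) auto
  then have "sin b / cos b \<le> sin b / (sin a * sin (a + b))"
    using s by (intro divide_left_mono) auto
  moreover have "cot a - cot (a + b) = sin b / (sin a * sin (a + b))"
  proof -
    have "sin b = sin ((a + b) - a)" by simp
    also have "\<dots> = sin (a + b) * cos a - cos (a + b) * sin a" by (rule sin_diff)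
    finally show ?thesis using s by (simp add: cot_def field_simps)
  qed
  ultimately show ?thesis by (simp add: ct)
qed

text \<open>
  A load \<open>(d, a)\<close> at a vertex \<open>v\<close> summarises the processed part hanging
  there by the lower bound \<open>\<omega> cot (load_angle d a) u(v)\<^sup>2\<close> for its
  energy. The number \<open>a\<close> is the collected length times \<open>\<omega>\<close>. The
  part satisfies a Dirichlet condition somewhere if \<open>d\<close> is true; otherwise all its
  ends are free, which shifts the angle by \<open>\<pi> / 2\<close>. The load \<open>(True,
  0)\<close> is a Dirichlet condition at \<open>v\<close> itself, \<open>(False, 0)\<close> is the
  absence of a load, and \<open>(True, \<pi> / 2)\<close> is a Neumann leaf that counts as an
  additional edge with a Dirichlet end.

  In the two cases of the theorem the parameter \<open>T\<close>, the value of \<open>a\<close>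
  beyond which a cut is made, is \<open>\<pi>\<close> and \<open>\<pi> / 2\<close>, respectively.
\<close>

definition load_angle :: "bool \<Rightarrow> real \<Rightarrow> real" where
  "load_angle d a = (if d then a else a + pi / 2)"

lemma join_loads:
  assumes a: "0 \<le> a1" "0 \<le> a2" "a1 + a2 < T"
    and T: "T = pi / 2 \<or> T = pi \<and> (d1 \<or> a1 = 0) \<and> (d2 \<or> a2 = 0)"
    and dir: "d1 \<and> a1 = 0 \<Longrightarrow> y = 0" "d2 \<and> a2 = 0 \<Longrightarrow> y = 0"
  shows "cot (load_angle (d1 \<or> d2) (a1 + a2)) * y\<^sup>2
    \<le> cot (load_angle d1 a1) * y\<^sup>2 + cot (load_angle d2 a2) * y\<^sup>2"
proof (cases "y = 0")
  case False
  have "cot (load_angle (d1 \<or> d2) (a1 + a2)) \<le> cot (load_angle d1 a1) + cot (load_angle d2 a2)"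
  proof (cases d1; cases d2)
    assume "d1" "d2"
    then show ?thesis using cot_superadditive[of a1 a2] a T dir False by (force simp: load_angle_def)
  next
    assume d: "d1" "\<not> d2"
    show ?thesis
    proof (cases "a2 = 0")
      case True
      then show ?thesis using d by (simp add: load_angle_def cot_def)
    next
      case False
      then show ?thesis using cot_mixed_superadditive[of a1 a2] a T dir d \<open>y \<noteq> 0\<close>
        by (force simp: load_angle_def)
    qed
  next
    assume d: "\<not> d1" "d2"
    show ?thesis
    proof (cases "a1 = 0")
      case True
      then show ?thesis using d by (simp add: load_angle_def cot_def)
    next
      case False
      then show ?thesis using cot_mixed_superadditive[of a2 a1] a T dir d \<open>y \<noteq> 0\<close>
        by (force simp: load_angle_def add.commute)
    qed
  next
    assume d: "\<not> d1" "\<not> d2"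
    show ?thesis
    proof (cases "a1 = 0 \<and> a2 = 0")
      case True
      then show ?thesis using d by (simp add: load_angle_def cot_def)
    next
      case False
      then show ?thesis using cot_shift_superadditive[of a1 a2] a T d
        by (force simp: load_angle_def)
    qed
  qed
  then show ?thesis by (metis distrib_right mult_right_mono zero_le_power2)
qed simp

text \<open>
  The vertex at which everything has been collected hangs nowhere, so a nonnegative coefficient is
  needed there. For this the total angle may reach \<open>T\<close>, and at least one part must
  contain a Dirichlet condition.
\<close>

lemma join_last_loads:
  assumes a: "0 < a1" "0 \<le> a2" "a1 + a2 \<le> T" and d: "d1 \<or> d2"
    and T: "T = pi / 2 \<or> T = pi \<and> d1 \<and> d2"
    and dir: "d2 \<and> a2 = 0 \<Longrightarrow> y = 0"
  shows "0 \<le> cot (load_angle d1 a1) * y\<^sup>2 + cot (load_angle d2 a2) * y\<^sup>2"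
proof (cases "y = 0")
  case False
  have pos: "d2 \<Longrightarrow> 0 < a2" using a(2) dir False by (cases "a2 = 0") auto
  have "0 < load_angle d1 a1" "0 < load_angle d2 a2" "load_angle d1 a1 + load_angle d2 a2 \<le> pi"
    using a d T pos pi_gt_zero unfolding load_angle_def by (auto split: if_splits)
  then have "0 \<le> cot (load_angle d1 a1) + cot (load_angle d2 a2)" by (rule cot_sum_nonneg)
  then show ?thesis by (simp flip: distrib_right)
qed simp

text \<open>
  Carrying a load from \<open>p\<close> to \<open>q\<close>, with a cut wherever the collected
  angle reaches \<open>T\<close>; after a cut the load is \<open>(True, 0)\<close>. A cut is
  postponed if it would fall on \<open>q\<close>, whence \<open>0 < a1 \<le> T\<close> at the end:
  there the load may still be joined to others, and at the last vertex no cut is spent on a total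
  of exactly \<open>T\<close>.
\<close>

lemma greedy_cuts_interval:
  assumes \<omega>: "\<omega> > 0" and T: "T = pi / 2 \<or> T = pi \<and> d" and a: "0 \<le> a" "a < T" and pq: "p < q"
  shows "\<exists>X d1 a1. finite X \<and> X \<subseteq> {p<..<q} \<and> 0 < a1 \<and> a1 \<le> T \<and>
    a + \<omega> * (q - p) = real (card X) * T + a1 \<and> (d1 \<longleftrightarrow> d \<or> X \<noteq> {}) \<and>
    (\<forall>u u'. c1_on p q u u' \<longrightarrow> (\<forall>x\<in>X. u x = 0) \<longrightarrow> (d \<and> a = 0 \<longrightarrow> u p = 0) \<longrightarrow>
      (load_angle d1 a1 = pi \<longrightarrow> u q = 0) \<longrightarrow>
      \<omega> * cot (load_angle d1 a1) * (u q)\<^sup>2 \<le> energy \<omega> p q u u' + \<omega> * cot (load_angle d a) * (u p)\<^sup>2)"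
proof -
  obtain n :: nat where "(a + \<omega> * (q - p)) / T \<le> n" using real_arch_simple by blast
  moreover have T0: "T > 0" using a by linarith
  ultimately have "a + \<omega> * (q - p) \<le> n * T" by (simp add: field_simps)
  with T a pq show ?thesis
  proof (induction n arbitrary: d a p)
    case 0
    have "\<omega> * (q - p) > 0" using \<omega> 0 by simp
    then show ?case using 0 by simp
  next
    case (Suc n)
    have start: "0 \<le> load_angle d a" "load_angle d a = 0 \<longleftrightarrow> d \<and> a = 0"
      using Suc.prems(2) add_nonneg_pos[OF Suc.prems(2), of "pi / 2"] by (auto simp: load_angle_def)
    have shift: "load_angle d (a + s) = load_angle d a + s" for s
      by (simp add: load_angle_def)
    have bound: "load_angle d (a + s) \<le> pi" if "a + s \<le> T" for s
    proof -
      have "T \<le> pi" "d \<or> T = pi / 2" using Suc.prems(1) pi_gt_zero by (linarith, blast)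
      then show ?thesis using that unfolding load_angle_def by (cases d) (simp_all add: field_simps)
    qed
    show ?case
    proof (cases "a + \<omega> * (q - p) \<le> T")
      case True
      have "\<omega> * (q - p) > 0" using \<omega> Suc.prems by simp
      moreover have "\<omega> * cot (load_angle d (a + \<omega> * (q - p))) * (u q)\<^sup>2
          \<le> energy \<omega> p q u u' + \<omega> * cot (load_angle d a) * (u p)\<^sup>2"
        if "c1_on p q u u'" "d \<and> a = 0 \<longrightarrow> u p = 0" "load_angle d (a + \<omega> * (q - p)) = pi \<longrightarrow> u q = 0" for u u'
        using Riccati_energy_bound[OF that(1) _ \<omega> start(1)] bound[OF True] Suc.prems start(2) that
        by (simp add: shift)
      ultimately show ?thesis
        using True Suc.prems by (intro exI[of _ "{}"] exI[of _ d] exI[of _ "a + \<omega> * (q - p)"]) auto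
    next
      case False
      \<comment> \<open>the point where the collected angle is \<open>T\<close>\<close>
      define x0 where "x0 = p + (T - a) / \<omega>"
      have x0: "\<omega> * (x0 - p) = T - a" using \<omega> by (simp add: x0_def)
      have px: "p < x0" using \<omega> Suc.prems by (simp add: x0_def)
      have "\<omega> * (q - x0) = a + \<omega> * (q - p) - T" using x0 by (simp add: algebra_simps)
      then have "\<omega> * (q - x0) > 0" using False by simp
      then have xq: "x0 < q" using \<omega> by (simp add: zero_less_mult_iff)
      have "0 + \<omega> * (q - x0) \<le> n * T"
        using Suc.prems(5) \<open>\<omega> * (q - x0) = _\<close> by (simp add: algebra_simps)
      then obtain X d1 a1 where X: "finite X" "X \<subseteq> {x0<..<q}" "0 < a1" "a1 \<le> T"
        "0 + \<omega> * (q - x0) = real (card X) * T + a1" "d1"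
        and ineq: "\<And>u u'. c1_on x0 q u u' \<Longrightarrow> (\<forall>x\<in>X. u x = 0) \<Longrightarrow> u x0 = 0 \<Longrightarrow>
          (load_angle d1 a1 = pi \<longrightarrow> u q = 0) \<Longrightarrow>
          \<omega> * cot (load_angle d1 a1) * (u q)\<^sup>2 \<le> energy \<omega> x0 q u u'"
        using Suc.IH[of True 0 x0] T0 T xq by (auto simp: load_angle_def)
      have card: "card (insert x0 X) = Suc (card X)" using X(1,2) by (subst card_insert_disjoint) auto
      have "\<omega> * cot (load_angle d1 a1) * (u q)\<^sup>2 \<le> energy \<omega> p q u u' + \<omega> * cot (load_angle d a) * (u p)\<^sup>2"
        if u: "c1_on p q u u'" "\<forall>x\<in>insert x0 X. u x = 0" "d \<and> a = 0 \<longrightarrow> u p = 0"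
          "load_angle d1 a1 = pi \<longrightarrow> u q = 0" for u u'
      proof -
        have "load_angle d a + \<omega> * (x0 - p) \<le> pi"
          using bound[of "T - a"] x0 by (simp add: load_angle_def split: if_splits)
        then have "0 \<le> energy \<omega> p x0 u u' + \<omega> * cot (load_angle d a) * (u p)\<^sup>2"
          using Riccati_energy_bound[OF c1_on_subinterval[OF u(1), of p x0] _ \<omega> start(1)]
            px xq start(2) u by simp
        moreover have "\<omega> * cot (load_angle d1 a1) * (u q)\<^sup>2 \<le> energy \<omega> x0 q u u'"
          using ineq[OF c1_on_subinterval[OF u(1), of x0 q]] px u by simp
        ultimately show ?thesis using energy_split[OF u(1), of x0 \<omega>] px xq by simp
      qed
      moreover have "a + \<omega> * (q - p) = real (Suc (card X)) * T + a1"
        using X(5) x0 by (simp add: algebra_simps)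
      ultimately show ?thesis using X px xq card
        by (intro exI[of _ "insert x0 X"] exI[of _ d1] exI[of _ a1]) auto
    qed
  qed
qed

lemma greedy_cuts_reversed:
  assumes \<omega>: "\<omega> > 0" and T: "T = pi / 2 \<or> T = pi \<and> d" and a: "0 \<le> a" "a < T" and l: "0 < l"
  shows "\<exists>X d1 a1. finite X \<and> X \<subseteq> {0<..<l} \<and> 0 < a1 \<and> a1 \<le> T \<and>
    a + \<omega> * l = real (card X) * T + a1 \<and> (d1 \<longleftrightarrow> d \<or> X \<noteq> {}) \<and>
    (\<forall>u u'. c1_on 0 l u u' \<longrightarrow> (\<forall>x\<in>X. u x = 0) \<longrightarrow> (d \<and> a = 0 \<longrightarrow> u l = 0) \<longrightarrow>
      (load_angle d1 a1 = pi \<longrightarrow> u 0 = 0) \<longrightarrow>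
      \<omega> * cot (load_angle d1 a1) * (u 0)\<^sup>2 \<le> energy \<omega> 0 l u u' + \<omega> * cot (load_angle d a) * (u l)\<^sup>2)"
proof -
  obtain X d1 a1 where X: "finite X" "X \<subseteq> {0<..<l}" "0 < a1" "a1 \<le> T"
    "a + \<omega> * (l - 0) = real (card X) * T + a1" "d1 \<longleftrightarrow> d \<or> X \<noteq> {}"
    and ineq: "\<forall>u u'. c1_on 0 l u u' \<longrightarrow> (\<forall>x\<in>X. u x = 0) \<longrightarrow> (d \<and> a = 0 \<longrightarrow> u 0 = 0) \<longrightarrow>
      (load_angle d1 a1 = pi \<longrightarrow> u l = 0) \<longrightarrow>
      \<omega> * cot (load_angle d1 a1) * (u l)\<^sup>2 \<le> energy \<omega> 0 l u u' + \<omega> * cot (load_angle d a) * (u 0)\<^sup>2"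
    using greedy_cuts_interval[OF \<omega> T a l] by blast
  have "card ((\<lambda>x. l - x) ` X) = card X" by (rule card_image) (auto simp: inj_on_def)
  moreover have "\<omega> * cot (load_angle d1 a1) * (u 0)\<^sup>2 \<le> energy \<omega> 0 l u u' + \<omega> * cot (load_angle d a) * (u l)\<^sup>2"
    if u: "c1_on 0 l u u'" "\<forall>x\<in>(\<lambda>x. l - x) ` X. u x = 0" "d \<and> a = 0 \<longrightarrow> u l = 0"
      "load_angle d1 a1 = pi \<longrightarrow> u 0 = 0" for u u'
    using ineq[rule_format, OF c1_on_reflect[OF u(1)]] u(2-) energy_reflect[OF u(1), of \<omega>] by simp
  ultimately show ?thesis using X
    by (intro exI[of _ "(\<lambda>x. l - x) ` X"] exI[of _ d1] exI[of _ a1]) auto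
qed

section \<open>The greedy choice of cut points\<close>

definition c1_on_graph ::
  "('v, 'e) pre_digraph \<Rightarrow> ('e \<Rightarrow> real) \<Rightarrow> ('e \<Rightarrow> real \<Rightarrow> real) \<Rightarrow> ('e \<Rightarrow> real \<Rightarrow> real) \<Rightarrow> ('v \<Rightarrow> real) \<Rightarrow> bool" where
  "c1_on_graph G len u u' f \<longleftrightarrow>
     (\<forall>e\<in>arcs G. c1_on 0 (len e) (u e) (u' e) \<and> u e 0 = f (tail G e) \<and> u e (len e) = f (head G e))"

lemma greedy_cuts_edge:
  assumes \<omega>: "\<omega> > 0" and T: "T = pi / 2 \<or> T = pi \<and> d" and a: "0 \<le> a" "a < T"
    and l: "0 < len e" and e: "e \<in> arcs G" "joins G e v w"
  shows "\<exists>X d1 a1. finite X \<and> X \<subseteq> {0<..<len e} \<and> 0 < a1 \<and> a1 \<le> T \<and>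
    a + \<omega> * len e = real (card X) * T + a1 \<and> (d1 \<longleftrightarrow> d \<or> X \<noteq> {}) \<and>
    (\<forall>u u' f. c1_on_graph G len u u' f \<longrightarrow> (\<forall>x\<in>X. u e x = 0) \<longrightarrow> (d \<and> a = 0 \<longrightarrow> f v = 0) \<longrightarrow>
      (load_angle d1 a1 = pi \<longrightarrow> f w = 0) \<longrightarrow>
      \<omega> * cot (load_angle d1 a1) * (f w)\<^sup>2
        \<le> energy \<omega> 0 (len e) (u e) (u' e) + \<omega> * cot (load_angle d a) * (f v)\<^sup>2)"
proof (cases "tail G e = v \<and> head G e = w")
  case True
  obtain X d1 a1 where X: "finite X" "X \<subseteq> {0<..<len e}" "0 < a1" "a1 \<le> T"
    "a + \<omega> * (len e - 0) = real (card X) * T + a1" "d1 \<longleftrightarrow> d \<or> X \<noteq> {}"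
    and ineq: "\<forall>u u'. c1_on 0 (len e) u u' \<longrightarrow> (\<forall>x\<in>X. u x = 0) \<longrightarrow> (d \<and> a = 0 \<longrightarrow> u 0 = 0) \<longrightarrow>
      (load_angle d1 a1 = pi \<longrightarrow> u (len e) = 0) \<longrightarrow>
      \<omega> * cot (load_angle d1 a1) * (u (len e))\<^sup>2 \<le> energy \<omega> 0 (len e) u u' + \<omega> * cot (load_angle d a) * (u 0)\<^sup>2"
    using greedy_cuts_interval[OF \<omega> T a l] by blast
  have "\<omega> * cot (load_angle d1 a1) * (f w)\<^sup>2
      \<le> energy \<omega> 0 (len e) (u e) (u' e) + \<omega> * cot (load_angle d a) * (f v)\<^sup>2"
    if u: "c1_on_graph G len u u' f" "\<forall>x\<in>X. u e x = 0" "d \<and> a = 0 \<longrightarrow> f v = 0"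
      "load_angle d1 a1 = pi \<longrightarrow> f w = 0" for u u' f
    using ineq[rule_format, of "u e" "u' e"] u e(1) True by (auto simp: c1_on_graph_def)
  then show ?thesis using X by (intro exI[of _ X] exI[of _ d1] exI[of _ a1]) auto
next
  case False
  then have vw: "tail G e = w" "head G e = v" using e(2) by (auto simp: joins_def)
  obtain X d1 a1 where X: "finite X" "X \<subseteq> {0<..<len e}" "0 < a1" "a1 \<le> T"
    "a + \<omega> * len e = real (card X) * T + a1" "d1 \<longleftrightarrow> d \<or> X \<noteq> {}"
    and ineq: "\<forall>u u'. c1_on 0 (len e) u u' \<longrightarrow> (\<forall>x\<in>X. u x = 0) \<longrightarrow> (d \<and> a = 0 \<longrightarrow> u (len e) = 0) \<longrightarrow>
      (load_angle d1 a1 = pi \<longrightarrow> u 0 = 0) \<longrightarrow>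
      \<omega> * cot (load_angle d1 a1) * (u 0)\<^sup>2 \<le> energy \<omega> 0 (len e) u u' + \<omega> * cot (load_angle d a) * (u (len e))\<^sup>2"
    using greedy_cuts_reversed[OF \<omega> T a l] by blast
  have "\<omega> * cot (load_angle d1 a1) * (f w)\<^sup>2
      \<le> energy \<omega> 0 (len e) (u e) (u' e) + \<omega> * cot (load_angle d a) * (f v)\<^sup>2"
    if u: "c1_on_graph G len u u' f" "\<forall>x\<in>X. u e x = 0" "d \<and> a = 0 \<longrightarrow> f v = 0"
      "load_angle d1 a1 = pi \<longrightarrow> f w = 0" for u u' f
    using ineq[rule_format, of "u e" "u' e"] u e(1) vw by (auto simp: c1_on_graph_def)
  then show ?thesis using X by (intro exI[of _ X] exI[of _ d1] exI[of _ a1]) auto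
qed

definition controlled ::
  "('v, 'e) pre_digraph \<Rightarrow> ('e \<Rightarrow> real) \<Rightarrow> real \<Rightarrow> 'e set \<Rightarrow> 'v set \<Rightarrow> ('v \<Rightarrow> bool) \<Rightarrow> ('v \<Rightarrow> real)
    \<Rightarrow> ('e \<times> real) set \<Rightarrow> bool" where
  "controlled G len \<omega> A W d a P \<longleftrightarrow>
     (\<forall>u u' f. c1_on_graph G len u u' f \<longrightarrow> (\<forall>(e, x)\<in>P. u e x = 0) \<longrightarrow>
       (\<forall>v\<in>W. d v \<and> a v = 0 \<longrightarrow> f v = 0) \<longrightarrow>
       0 \<le> (\<Sum>e\<in>A. energy \<omega> 0 (len e) (u e) (u' e)) + (\<Sum>v\<in>W. \<omega> * cot (load_angle (d v) (a v)) * (f v)\<^sup>2))"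

context quantum_graph
begin

text \<open>
  The next edge \<open>e\<close> to process. Either \<open>v\<close> is a leaf and its load
  \<open>(d0, a0)\<close> is carried along \<open>e\<close> to \<open>w\<close>, or
  \<open>e\<close> is not a bridge and is detached from \<open>v\<close>, so that it becomes a
  pendant edge at \<open>w\<close> with a free end. The free end is charged with the angle
  \<open>\<kappa>\<close>, which is \<open>\<pi> / 2\<close> if \<open>T = \<pi>\<close> and
  \<open>0\<close> otherwise, and this charge is paid by the first Betti number, which drops by
  one. If \<open>T = \<pi>\<close>, every leaf must carry a load with a Dirichlet condition. That
  is why \<open>v\<close> is then required to have such a load or degree at least three: it must
  not become a bare leaf when \<open>e\<close> is detached.
\<close>

lemma reduction_step:
  assumes T: "T = pi \<and> \<kappa> = pi / 2 \<or> T = pi / 2 \<and> \<kappa> = 0"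
    and A: "A \<subseteq> arcs G" "A \<noteq> {}" and W: "W \<subseteq> verts G" and con: "cut_connected G W A"
    and loads: "\<And>v. v \<in> W \<Longrightarrow> 0 \<le> a v \<and> a v < T \<and> (d v \<or> T = pi / 2 \<or> a v = 0)"
    and leaves: "\<And>v. v \<in> W \<Longrightarrow> subdegree G A v = 1 \<Longrightarrow> d v \<or> T = pi / 2"
    and special: "T = pi / 2 \<or> (\<exists>v\<in>W. d v \<or> subdegree G A v \<ge> 3)"
  obtains e v w d0 a0 W' where
    "e \<in> A" "joins G e v w" "W' \<subseteq> W" "w \<in> W'" "cut_connected G W' (A - {e})"
    "0 \<le> a0" "a0 < T" "d0 \<or> T = pi / 2"
    "(\<Sum>z\<in>W. a z) + (real (card A) - real (card W) + 1) * \<kappa>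
      = a0 + (\<Sum>z\<in>W'. a z) + (real (card (A - {e})) - real (card W') + 1) * \<kappa>"
    "\<forall>f \<omega>. (\<Sum>z\<in>W. \<omega> * cot (load_angle (d z) (a z)) * (f z)\<^sup>2)
      = \<omega> * cot (load_angle d0 a0) * (f v)\<^sup>2 + (\<Sum>z\<in>W'. \<omega> * cot (load_angle (d z) (a z)) * (f z)\<^sup>2)"
    "\<forall>f :: 'v \<Rightarrow> real. (\<forall>z\<in>W. d z \<and> a z = 0 \<longrightarrow> f z = 0) \<longrightarrow> d0 \<and> a0 = 0 \<longrightarrow> f v = 0"
    "\<forall>z\<in>W'. z \<noteq> w \<longrightarrow> subdegree G (A - {e}) z = 1 \<longrightarrow> d z \<or> T = pi / 2"
    "(\<exists>z\<in>W. d z) \<longrightarrow> d0 \<or> (\<exists>z\<in>W'. d z)"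
    "A = {e} \<longrightarrow> d w \<or> T = pi / 2"
proof -
  have finA: "finite A" using A finite_arcs finite_subset by blast
  have finW: "finite W" using W finite_verts finite_subset by blast
  have cardA: "real (card A) = real (card (A - {e})) + 1" if "e \<in> A" for e
    using card_Suc_Diff1[OF finA that] by linarith
  show thesis
  proof (cases "\<exists>v\<in>W. subdegree G A v = 1")
    case True
    then obtain v where v: "v \<in> W" "subdegree G A v = 1" by blast
    then have "subdegree G A v > 0" by simp
    then obtain e w where e: "e \<in> A" "joins G e v w" by (rule subdegree_pos_joins)
    note leaf = cut_connected_remove_leaf[OF con finA e v(2)]
    have w: "w \<in> W" using joins_ends[OF con e] by simp
    have sum: "(\<Sum>z\<in>W. g z) = g v + (\<Sum>z\<in>W - {v}. g z)" for g :: "'v \<Rightarrow> real"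
      using sum.remove[OF finW v(1)] by blast
    have cardW: "real (card W) = real (card (W - {v})) + 1"
      using card_Suc_Diff1[OF finW v(1)] by linarith
    show thesis
    proof (rule that[of e v w "W - {v}" "a v" "d v"])
      show "(\<Sum>z\<in>W. a z) + (real (card A) - real (card W) + 1) * \<kappa>
        = a v + (\<Sum>z\<in>W - {v}. a z) + (real (card (A - {e})) - real (card (W - {v})) + 1) * \<kappa>"
        using sum[of a] cardW cardA[OF e(1)] by simp
      have "d w \<or> T = pi / 2" if "A = {e}"
      proof -
        have "subdegree G A w = 1"
          using subdegree_remove[OF finA e(1), of G w] e(2) leaf(1) that
          by (auto simp: joins_def subdegree_def)
        then show ?thesis using leaves w by blast
      qed
      then show "A = {e} \<longrightarrow> d w \<or> T = pi / 2" by blast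
    qed (use e leaf w v sum loads leaves in auto)
  next
    case False
    have deg: "subdegree G A v \<ge> 2" if "v \<in> W" for v
      using cut_connected_subdegree_pos[OF con that finA A(2)] False that
      by (metis One_nat_def Suc_leI le_neq_implies_less numeral_2_eq_2)
    define Z where "Z = {v \<in> W. T = pi / 2 \<or> d v \<or> subdegree G A v \<ge> 3}"
    obtain z where z: "z \<in> W" "z \<in> Z"
    proof -
      have "W \<noteq> {}" using A(2) con by (auto simp: cut_connected_def)
      then show ?thesis using special that by (auto simp: Z_def)
    qed
    have "subdegree G A v \<le> 2" if "v \<in> W - Z" for v using that by (auto simp: Z_def)
    then obtain e y w where e: "e \<in> A" "joins G e y w" and y: "y \<in> Z" and con': "cut_connected G W (A - {e})"
      using exists_removable_edge[OF con finA finW deg _ z] by blast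
    have yw: "y \<in> W" "w \<in> W" using joins_ends[OF con e] by simp_all
    show thesis
    proof (rule that[of e y w W \<kappa> "T = pi"])
      have "load_angle (T = pi) \<kappa> = pi / 2" using T pi_gt_zero unfolding load_angle_def by (elim disjE) auto
      then have "cot (load_angle (T = pi) \<kappa>) = 0" by (simp only: cot_def cos_pi_half div_0)
      then show "\<forall>f \<omega>. (\<Sum>z\<in>W. \<omega> * cot (load_angle (d z) (a z)) * (f z)\<^sup>2)
        = \<omega> * cot (load_angle (T = pi) \<kappa>) * (f y)\<^sup>2 + (\<Sum>z\<in>W. \<omega> * cot (load_angle (d z) (a z)) * (f z)\<^sup>2)"
        by simp
      have "d x \<or> T = pi / 2" if x: "x \<in> W" "x \<noteq> w" "subdegree G (A - {e}) x = 1" for x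
      proof (cases "x = y")
        case True
        then have "subdegree G A x = 2"
          using subdegree_remove[OF finA e(1), of G x] e(2) x by (auto simp: joins_def)
        then show ?thesis using y True by (auto simp: Z_def)
      next
        case False
        then have "subdegree G A x = 1"
          using subdegree_remove[OF finA e(1), of G x] e(2) x by (auto simp: joins_def)
        then show ?thesis using deg[OF x(1)] by simp
      qed
      then show "\<forall>z\<in>W. z \<noteq> w \<longrightarrow> subdegree G (A - {e}) z = 1 \<longrightarrow> d z \<or> T = pi / 2" by blast
      have "d w \<or> T = pi / 2" if "A = {e}"
      proof -
        have "W = {w}" using con' yw(2) that by (auto simp: cut_connected_def)
        then have "y = w" using yw by simp
        moreover have "subdegree G A w \<le> 2"
          using subdegree_remove[OF finA e(1), of G w] that by (auto simp: subdegree_def)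
        ultimately show ?thesis using y by (auto simp: Z_def)
      qed
      then show "A = {e} \<longrightarrow> d w \<or> T = pi / 2" by blast
      show "0 \<le> \<kappa>" "\<kappa> < T" using T pi_gt_zero by linarith+
      show "(\<Sum>z\<in>W. a z) + (real (card A) - real (card W) + 1) * \<kappa>
        = \<kappa> + (\<Sum>z\<in>W. a z) + (real (card (A - {e})) - real (card W) + 1) * \<kappa>"
        using cardA[OF e(1)] by (simp add: algebra_simps)
    qed (use e con' yw T in auto)
  qed
qed

lemma vertex_point:
  assumes "e \<in> arcs G" "joins G e v w"
  obtains p where "p \<in> Sigma (arcs G) (\<lambda>e. {0..len e})"
    "\<And>u u' f. c1_on_graph G len u u' f \<Longrightarrow> u (fst p) (snd p) = f w"
proof (rule that[of "(e, if tail G e = w then 0 else len e)"])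
  show "(e, if tail G e = w then 0 else len e) \<in> Sigma (arcs G) (\<lambda>e. {0..len e})"
    using assms(1) len_pos[OF assms(1)] by auto
qed (use assms in \<open>auto simp: c1_on_graph_def joins_def\<close>)

text \<open>
  The greedy algorithm. The left side of the last assumption is the total angle: that of the
  remaining edges, that of the loads, and the charge \<open>\<kappa>\<close> for each detachment
  to come. Each cut lowers it by at least \<open>T\<close>, and the last piece may keep an angle
  of \<open>T\<close>, so that fewer than \<open>m\<close> cuts are made. Since \<open>m\<close>
  is an integer and not a natural number, no positivity has to be maintained during the induction.
  The assumption before the last one guarantees, for \<open>T = \<pi> / 2\<close>, that the last
  piece contains a Dirichlet condition: either there is one, or a cut can be afforded.
\<close>

lemma exists_controlling_points:
  assumes \<omega>: "\<omega> > 0" and T: "T = pi \<and> \<kappa> = pi / 2 \<or> T = pi / 2 \<and> \<kappa> = 0"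
    and A: "A \<subseteq> arcs G" "A \<noteq> {}" and W: "W \<subseteq> verts G" and con: "cut_connected G W A"
    and loads: "\<And>v. v \<in> W \<Longrightarrow> 0 \<le> a v \<and> a v < T \<and> (d v \<or> T = pi / 2 \<or> a v = 0)"
    and leaves: "\<And>v. v \<in> W \<Longrightarrow> subdegree G A v = 1 \<Longrightarrow> d v \<or> T = pi / 2"
    and special: "T = pi / 2 \<or> (\<exists>v\<in>W. d v \<or> subdegree G A v \<ge> 3)"
    and flags: "T = pi \<or> m \<ge> 2 \<or> (\<exists>v\<in>W. d v)"
    and budget: "\<omega> * (\<Sum>e\<in>A. len e) + (\<Sum>v\<in>W. a v) + (real (card A) - real (card W) + 1) * \<kappa>
      \<le> real_of_int m * T"
  shows "\<exists>P. finite P \<and> P \<subseteq> Sigma (arcs G) (\<lambda>e. {0..len e}) \<and> int (card P) < m \<and>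
    controlled G len \<omega> A W d a P"
proof -
  have "finite A" using A finite_arcs finite_subset by blast
  then show ?thesis
    using A W con loads leaves special flags budget
  proof (induction A arbitrary: W d a m rule: finite_psubset_induct)
    case (psubset A)
    note finA = psubset.hyps(1)
    have finW: "finite W" using psubset.prems(3) finite_verts finite_subset by blast
    have T0: "T > 0" "T \<noteq> pi / 2 \<longleftrightarrow> T = pi" using T pi_gt_zero by linarith+
    obtain e v w d0 a0 W' where e: "e \<in> A" "joins G e v w" and W': "W' \<subseteq> W" "w \<in> W'"
      and con': "cut_connected G W' (A - {e})" and start: "0 \<le> a0" "a0 < T" "d0 \<or> T = pi / 2"
      and budget': "(\<Sum>z\<in>W. a z) + (real (card A) - real (card W) + 1) * \<kappa>
        = a0 + (\<Sum>z\<in>W'. a z) + (real (card (A - {e})) - real (card W') + 1) * \<kappa>"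
      and form0: "\<forall>f \<omega>. (\<Sum>z\<in>W. \<omega> * cot (load_angle (d z) (a z)) * (f z)\<^sup>2)
        = \<omega> * cot (load_angle d0 a0) * (f v)\<^sup>2 + (\<Sum>z\<in>W'. \<omega> * cot (load_angle (d z) (a z)) * (f z)\<^sup>2)"
      and dir0: "\<forall>f :: 'v \<Rightarrow> real. (\<forall>z\<in>W. d z \<and> a z = 0 \<longrightarrow> f z = 0) \<longrightarrow> d0 \<and> a0 = 0 \<longrightarrow> f v = 0"
      and leaves0: "\<forall>z\<in>W'. z \<noteq> w \<longrightarrow> subdegree G (A - {e}) z = 1 \<longrightarrow> d z \<or> T = pi / 2"
      and flags': "(\<exists>z\<in>W. d z) \<longrightarrow> d0 \<or> (\<exists>z\<in>W'. d z)"
      and last: "A = {e} \<longrightarrow> d w \<or> T = pi / 2"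
    proof (rule reduction_step[where a = a and d = d, OF T psubset.prems(1-4)], goal_cases)
      case (1 v)
      show ?case by (rule psubset.prems(5)[OF 1(2)])
    next
      case (2 v)
      show ?case by (rule psubset.prems(6)[OF 2(2,3)])
    next
      case 3
      show ?case by (rule psubset.prems(7))
    next
      case (4 e v w d0 a0 W')
      show ?case by (rule 4(1)) (fact 4)+
    qed
    have form: "(\<Sum>z\<in>W. \<omega> * cot (load_angle (d z) (a z)) * (f z)\<^sup>2)
        = \<omega> * cot (load_angle d0 a0) * (f v)\<^sup>2 + (\<Sum>z\<in>W'. \<omega> * cot (load_angle (d z) (a z)) * (f z)\<^sup>2)" for f \<omega>
      using form0 by blast
    have dir: "d0 \<and> a0 = 0 \<Longrightarrow> f v = 0" if "\<forall>z\<in>W. d z \<and> a z = 0 \<longrightarrow> f z = 0" for f :: "'v \<Rightarrow> real"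
      using dir0 that by blast
    have leaves': "d z \<or> T = pi / 2" if "z \<in> W'" "z \<noteq> w" "subdegree G (A - {e}) z = 1" for z
      using leaves0 that by blast
    have eG: "e \<in> arcs G" using e psubset.prems by blast
    have lw: "0 \<le> a w" "a w < T" "d w \<or> T = pi / 2 \<or> a w = 0" and wW: "w \<in> W"
      using psubset.prems(5)[of w] W' by auto
    have finW': "finite W'" using W' finW finite_subset by blast
    have Tstart: "T = pi / 2 \<or> T = pi \<and> d0" using T start by auto
    obtain X d1 a1 where X: "finite X" "X \<subseteq> {0<..<len e}" and a1: "0 < a1" "a1 \<le> T"
      and len: "a0 + \<omega> * len e = real (card X) * T + a1" and d1: "d1 \<longleftrightarrow> d0 \<or> X \<noteq> {}"
      and edge: "\<And>u u' f. c1_on_graph G len u u' f \<Longrightarrow> (\<forall>x\<in>X. u e x = 0) \<Longrightarrow>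
        (d0 \<and> a0 = 0 \<longrightarrow> f v = 0) \<Longrightarrow> (load_angle d1 a1 = pi \<longrightarrow> f w = 0) \<Longrightarrow>
        \<omega> * cot (load_angle d1 a1) * (f w)\<^sup>2
          \<le> energy \<omega> 0 (len e) (u e) (u' e) + \<omega> * cot (load_angle d0 a0) * (f v)\<^sup>2"
      using greedy_cuts_edge[OF \<omega> Tstart start(1,2), of len e G v w] len_pos[OF eG] eG e(2) by blast
    \<comment> \<open>the cuts inside \<open>e\<close>, and a point that represents the vertex \<open>w\<close>, for a cut at \<open>w\<close>\<close>
    define PX where "PX = (\<lambda>x. (e, x)) ` X"
    have PX: "finite PX" "PX \<subseteq> Sigma (arcs G) (\<lambda>e. {0..len e})" "card PX = card X"
      using X eG by (auto simp: PX_def card_image inj_on_def)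
    obtain pw where pw: "pw \<in> Sigma (arcs G) (\<lambda>e. {0..len e})"
      "\<And>u u' f. c1_on_graph G len u u' f \<Longrightarrow> u (fst pw) (snd pw) = f w"
      using vertex_point[OF eG e(2)] by blast
    have sumA: "(\<Sum>x\<in>A. g x) = g e + (\<Sum>x\<in>A - {e}. g x)" for g :: "'e \<Rightarrow> real"
      using sum.remove[OF finA e(1)] by blast
    have sumW': "(\<Sum>z\<in>W'. g z) = g w + (\<Sum>z\<in>W' - {w}. g z)" for g :: "'v \<Rightarrow> real"
      using sum.remove[OF finW' W'(2)] by blast
    define r where "r = (real (card (A - {e})) - real (card W') + 1) * \<kappa>"
    define S where "S = (\<Sum>x\<in>A - {e}. len x)"
    define R where "R = (\<Sum>z\<in>W' - {w}. a z)"
    have total: "real (card X) * T + a1 + a w + \<omega> * S + R + r \<le> real_of_int m * T"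
      using psubset.prems(9) budget' len sumA[of len] sumW'[of a]
      by (simp add: r_def S_def R_def algebra_simps)
    have on_edge: "\<omega> * cot (load_angle d1 a1) * (f w)\<^sup>2 + (\<Sum>x\<in>A - {e}. energy \<omega> 0 (len x) (u x) (u' x))
          + (\<Sum>z\<in>W'. \<omega> * cot (load_angle (d z) (a z)) * (f z)\<^sup>2)
        \<le> (\<Sum>x\<in>A. energy \<omega> 0 (len x) (u x) (u' x)) + (\<Sum>z\<in>W. \<omega> * cot (load_angle (d z) (a z)) * (f z)\<^sup>2)"
      if "c1_on_graph G len u u' f" "\<forall>(e, x)\<in>PX. u e x = 0" "\<forall>z\<in>W. d z \<and> a z = 0 \<longrightarrow> f z = 0"
        "load_angle d1 a1 = pi \<longrightarrow> f w = 0" for u u' f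
      using edge[OF that(1) _ _ that(4)] that(2) dir[OF that(3)] form[of \<omega> f]
        sumA[of "\<lambda>x. energy \<omega> 0 (len x) (u x) (u' x)"] by (auto simp: PX_def)
    show ?case
    proof (cases "A = {e}")
      case True
      \<comment> \<open>All edges but \<open>e\<close> have been processed, so everything is collected at \<open>w\<close>.\<close>
      have W'w: "W' = {w}" using con' W'(2) True by (auto simp: cut_connected_def)
      have total': "real (card X) * T + a1 + a w \<le> real_of_int m * T"
        using total True W'w by (simp add: r_def S_def R_def)
      have dw: "d w \<or> T = pi / 2" using last True by blast
      show ?thesis
      proof (cases "a1 + a w \<le> T \<and> (d1 \<or> d w)")
        case ok: True
        have "real (card X) * T < real_of_int m * T" using total' a1 lw by linarith
        then have "real (card X) < real_of_int m" using T0 by simp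
        then have "int (card PX) < m" unfolding PX(3) by linarith
        moreover have "controlled G len \<omega> A W d a PX"
          unfolding controlled_def
        proof (intro allI impI)
          fix u u' f assume u: "c1_on_graph G len u u' f" "\<forall>(e, x)\<in>PX. u e x = 0" "\<forall>v\<in>W. d v \<and> a v = 0 \<longrightarrow> f v = 0"
          have fw: "d w \<and> a w = 0 \<Longrightarrow> f w = 0" using u(3) wW by blast
          have "load_angle d1 a1 = pi \<longrightarrow> f w = 0"
            using fw ok lw dw T start(3) d1 pi_gt_zero by (auto simp: load_angle_def split: if_splits)
          note 1 = on_edge[OF u this]
          have "0 \<le> cot (load_angle d1 a1) * (f w)\<^sup>2 + cot (load_angle (d w) (a w)) * (f w)\<^sup>2"
            using join_last_loads[of a1 "a w" T d1 "d w" "f w"] a1 lw ok fw T dw start(3) d1 by auto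
          then have "0 \<le> \<omega> * (cot (load_angle d1 a1) * (f w)\<^sup>2 + cot (load_angle (d w) (a w)) * (f w)\<^sup>2)"
            using \<omega> by simp
          then have 2: "0 \<le> \<omega> * cot (load_angle d1 a1) * (f w)\<^sup>2 + \<omega> * cot (load_angle (d w) (a w)) * (f w)\<^sup>2"
            by (simp only: distrib_left mult.assoc)
          have 3: "(\<Sum>x\<in>A - {e}. energy \<omega> 0 (len x) (u x) (u' x)) = 0"
            "(\<Sum>z\<in>W'. \<omega> * cot (load_angle (d z) (a z)) * (f z)\<^sup>2) = \<omega> * cot (load_angle (d w) (a w)) * (f w)\<^sup>2"
            unfolding W'w using True by auto
          show "0 \<le> (\<Sum>e\<in>A. energy \<omega> 0 (len e) (u e) (u' e))
            + (\<Sum>v\<in>W. \<omega> * cot (load_angle (d v) (a v)) * (f v)\<^sup>2)"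
            using 1 2 unfolding 3 by linarith
        qed
        ultimately show ?thesis using PX(1,2) by blast
      next
        case bad: False
        have "int (card X) + 1 < m"
        proof (cases "a1 + a w \<le> T")
          case True
          then have "\<not> d1" "\<not> d w" using bad by blast+
          then have "X = {}" "\<not> d0" "\<not> (\<exists>z\<in>W. d z)" using d1 flags' unfolding W'w by blast+
          then show ?thesis using psubset.prems(8) T0(2) start(3) pi_gt_zero by auto
        next
          case False
          then have "(real (card X) + 1) * T < real_of_int m * T" using total' by (simp add: algebra_simps)
          then have "real (card X) + 1 < real_of_int m" using T0 by simp
          then show ?thesis by linarith
        qed
        then have "int (card (insert pw PX)) < m"
          using card_insert_le_m1[of "Suc (card X)" PX pw] PX by (simp add: card_insert_if)
        moreover have "controlled G len \<omega> A W d a (insert pw PX)"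
          unfolding controlled_def
        proof (intro allI impI)
          fix u u' f assume u: "c1_on_graph G len u u' f" "\<forall>(e, x)\<in>insert pw PX. u e x = 0" "\<forall>v\<in>W. d v \<and> a v = 0 \<longrightarrow> f v = 0"
          have fw: "f w = 0" using pw(2)[OF u(1)] u(2) by (auto simp: case_prod_beta)
          have uX: "\<forall>(e, x)\<in>PX. u e x = 0" using u(2) by blast
          have 3: "(\<Sum>x\<in>A - {e}. energy \<omega> 0 (len x) (u x) (u' x)) = 0"
            "(\<Sum>z\<in>W'. \<omega> * cot (load_angle (d z) (a z)) * (f z)\<^sup>2) = 0"
            unfolding W'w using True fw by auto
          from fw have "load_angle d1 a1 = pi \<longrightarrow> f w = 0" by blast
          from on_edge[OF u(1) uX u(3) this] show "0 \<le> (\<Sum>e\<in>A. energy \<omega> 0 (len e) (u e) (u' e))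
            + (\<Sum>v\<in>W. \<omega> * cot (load_angle (d v) (a v)) * (f v)\<^sup>2)"
            unfolding 3 fw by simp
        qed
        moreover have "finite (insert pw PX)" "insert pw PX \<subseteq> Sigma (arcs G) (\<lambda>e. {0..len e})"
          using PX pw(1) by blast+
        ultimately show ?thesis by blast
      qed
    next
      case False
      have sub: "A - {e} \<subset> A" "A - {e} \<subseteq> arcs G" "A - {e} \<noteq> {}" "W' \<subseteq> verts G"
        using e psubset.prems W' False by auto
      \<comment> \<open>The induction hypothesis, for a new load \<open>(d2, a2)\<close> at \<open>w\<close>; it is applied with the sum of
        the loads, or with \<open>(True, 0)\<close> if that sum is too large and \<open>w\<close> is made a cut point.\<close>
      have step: "\<exists>P. finite P \<and> P \<subseteq> Sigma (arcs G) (\<lambda>e. {0..len e}) \<and> int (card P) < m' \<and>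
          controlled G len \<omega> (A - {e}) W' (d(w := d2)) (a(w := a2)) P"
        if a2: "0 \<le> a2" "a2 < T" and d2: "d2 \<longleftrightarrow> d1 \<or> d w \<or> a1 + a w \<ge> T"
          and m': "m' \<ge> 2 \<or> m' = m \<or> d2" and cost: "real_of_int m' * T \<ge> real_of_int m * T - real (card X) * T - a1 - a w + a2"
        for a2 d2 m'
      proof (rule psubset.IH[OF sub(1,2,3,4) con'])
        have d2T: "d2 \<or> T = pi / 2" using d2 d1 start(3) by blast
        show "0 \<le> (a(w := a2)) z \<and> (a(w := a2)) z < T \<and> ((d(w := d2)) z \<or> T = pi / 2 \<or> (a(w := a2)) z = 0)"
          if "z \<in> W'" for z
          using psubset.prems(5)[of z] that W' a2 d2T by auto
        show "(d(w := d2)) z \<or> T = pi / 2" if "z \<in> W'" "subdegree G (A - {e}) z = 1" for z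
          using leaves'[of z] that d2T by auto
        show "T = pi / 2 \<or> (\<exists>z\<in>W'. (d(w := d2)) z \<or> 3 \<le> subdegree G (A - {e}) z)"
          using d2T W'(2) by auto
        show "T = pi \<or> 2 \<le> m' \<or> (\<exists>z\<in>W'. (d(w := d2)) z)"
        proof (cases d2)
          case True
          then show ?thesis using W'(2) by auto
        next
          case False
          then have "\<not> d0" "\<not> d w" using d2 d1 by auto
          moreover have "\<exists>z\<in>W'. (d(w := d2)) z" if "\<exists>z\<in>W. d z"
            using flags' that \<open>\<not> d0\<close> \<open>\<not> d w\<close> by auto
          ultimately show ?thesis using psubset.prems(8) m' False by blast
        qed
        have "(\<Sum>z\<in>W'. (a(w := a2)) z) = a2 + R"
          using sumW'[of "a(w := a2)"] by (simp add: R_def)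
        then show "\<omega> * (\<Sum>e\<in>A - {e}. len e) + (\<Sum>z\<in>W'. (a(w := a2)) z)
            + (real (card (A - {e})) - real (card W') + 1) * \<kappa> \<le> real_of_int m' * T"
          using total cost unfolding S_def[symmetric] r_def[symmetric] by linarith
      qed
      have rest: "(\<Sum>z\<in>W'. \<omega> * cot (load_angle ((d(w := d2)) z) ((a(w := a2)) z)) * (f z)\<^sup>2)
        = \<omega> * cot (load_angle d2 a2) * (f w)\<^sup>2 + (\<Sum>z\<in>W' - {w}. \<omega> * cot (load_angle (d z) (a z)) * (f z)\<^sup>2)"
        for f d2 a2 by (subst sumW') simp
      show ?thesis
      proof (cases "a1 + a w < T")
        case small: True
        obtain P where P: "finite P" "P \<subseteq> Sigma (arcs G) (\<lambda>e. {0..len e})" "int (card P) < m - int (card X)"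
          and ctrl: "controlled G len \<omega> (A - {e}) W' (d(w := d1 \<or> d w)) (a(w := a1 + a w)) P"
          using step[of "a1 + a w" "d1 \<or> d w" "m - int (card X)"] a1 lw small d1 X(1)
          by (auto simp: algebra_simps)
        have "controlled G len \<omega> A W d a (PX \<union> P)"
          unfolding controlled_def
        proof (intro allI impI)
          fix u u' f assume u: "c1_on_graph G len u u' f" "\<forall>(e, x)\<in>PX \<union> P. u e x = 0" "\<forall>v\<in>W. d v \<and> a v = 0 \<longrightarrow> f v = 0"
          have uX: "\<forall>(e, x)\<in>PX. u e x = 0" and uP: "\<forall>(e, x)\<in>P. u e x = 0" using u(2) by blast+
          have "load_angle d1 a1 \<noteq> pi"
            using small lw T start(3) d1 by (auto simp: load_angle_def split: if_splits)
          then have "load_angle d1 a1 = pi \<longrightarrow> f w = 0" by blast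
          note 1 = on_edge[OF u(1) uX u(3) this]
          have "\<forall>v\<in>W'. (d(w := d1 \<or> d w)) v \<and> (a(w := a1 + a w)) v = 0 \<longrightarrow> f v = 0"
            using u(3) W' a1 lw by auto
          then have 2: "0 \<le> (\<Sum>x\<in>A - {e}. energy \<omega> 0 (len x) (u x) (u' x))
            + (\<Sum>z\<in>W'. \<omega> * cot (load_angle ((d(w := d1 \<or> d w)) z) ((a(w := a1 + a w)) z)) * (f z)\<^sup>2)"
            using ctrl u(1) uP unfolding controlled_def by blast
          have "cot (load_angle (d1 \<or> d w) (a1 + a w)) * (f w)\<^sup>2
            \<le> cot (load_angle d1 a1) * (f w)\<^sup>2 + cot (load_angle (d w) (a w)) * (f w)\<^sup>2"
            by (rule join_loads[where T = T]) (use a1 lw small T start(3) d1 u(3) wW in auto)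
          then have "\<omega> * (cot (load_angle (d1 \<or> d w) (a1 + a w)) * (f w)\<^sup>2)
            \<le> \<omega> * (cot (load_angle d1 a1) * (f w)\<^sup>2 + cot (load_angle (d w) (a w)) * (f w)\<^sup>2)"
            using \<omega> by simp
          then have 3: "\<omega> * cot (load_angle (d1 \<or> d w) (a1 + a w)) * (f w)\<^sup>2
            \<le> \<omega> * cot (load_angle d1 a1) * (f w)\<^sup>2 + \<omega> * cot (load_angle (d w) (a w)) * (f w)\<^sup>2"
            by (simp only: distrib_left mult.assoc)
          then show "0 \<le> (\<Sum>e\<in>A. energy \<omega> 0 (len e) (u e) (u' e))
            + (\<Sum>v\<in>W. \<omega> * cot (load_angle (d v) (a v)) * (f v)\<^sup>2)"
            using 1 2 3 sumW'[of "\<lambda>z. \<omega> * cot (load_angle (d z) (a z)) * (f z)\<^sup>2"]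
            unfolding rest by linarith
        qed
        moreover have "int (card (PX \<union> P)) < m" using card_Un_le[of PX P] PX P by linarith
        moreover have "finite (PX \<union> P)" "PX \<union> P \<subseteq> Sigma (arcs G) (\<lambda>e. {0..len e})"
          using PX P by blast+
        ultimately show ?thesis by blast
      next
        case big: False
        obtain P where P: "finite P" "P \<subseteq> Sigma (arcs G) (\<lambda>e. {0..len e})" "int (card P) < m - int (card X) - 1"
          and ctrl: "controlled G len \<omega> (A - {e}) W' (d(w := True)) (a(w := 0)) P"
          using step[of 0 True "m - int (card X) - 1"] T0 big
          by (auto simp: algebra_simps)
        have "controlled G len \<omega> A W d a (insert pw (PX \<union> P))"
          unfolding controlled_def
        proof (intro allI impI)
          fix u u' f assume u: "c1_on_graph G len u u' f" "\<forall>(e, x)\<in>insert pw (PX \<union> P). u e x = 0" "\<forall>v\<in>W. d v \<and> a v = 0 \<longrightarrow> f v = 0"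
          have uX: "\<forall>(e, x)\<in>PX. u e x = 0" and uP: "\<forall>(e, x)\<in>P. u e x = 0" using u(2) by blast+
          have fw: "f w = 0" using pw(2)[OF u(1)] u(2) by (auto simp: case_prod_beta)
          then have "load_angle d1 a1 = pi \<longrightarrow> f w = 0" by blast
          note 1 = on_edge[OF u(1) uX u(3) this]
          have "\<forall>v\<in>W'. (d(w := True)) v \<and> (a(w := 0)) v = 0 \<longrightarrow> f v = 0"
            using u(3) W' fw by auto
          then have 2: "0 \<le> (\<Sum>x\<in>A - {e}. energy \<omega> 0 (len x) (u x) (u' x))
            + (\<Sum>z\<in>W'. \<omega> * cot (load_angle ((d(w := True)) z) ((a(w := 0)) z)) * (f z)\<^sup>2)"
            using ctrl u(1) uP unfolding controlled_def by blast
          show "0 \<le> (\<Sum>e\<in>A. energy \<omega> 0 (len e) (u e) (u' e))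
            + (\<Sum>v\<in>W. \<omega> * cot (load_angle (d v) (a v)) * (f v)\<^sup>2)"
            using 1 2 sumW'[of "\<lambda>z. \<omega> * cot (load_angle (d z) (a z)) * (f z)\<^sup>2"]
            unfolding rest fw by simp
        qed
        moreover have "int (card (insert pw (PX \<union> P))) < m"
          using card_Un_le[of PX P] PX P card_insert_le_m1[of "Suc (card (PX \<union> P))" "PX \<union> P" pw]
          by (simp add: card_insert_if)
        moreover have "finite (insert pw (PX \<union> P))" "insert pw (PX \<union> P) \<subseteq> Sigma (arcs G) (\<lambda>e. {0..len e})"
          using PX P pw(1) by blast+
        ultimately show ?thesis by blast
      qed
    qed
  qed
qed

end

section \<open>From cut points to eigenvalues\<close>

lemma sum_fun_apply: "(\<Sum>i\<in>I. F i) x = (\<Sum>i\<in>I. F i x)"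
  by (induction I rule: infinite_finite_induct) auto

text \<open>
  One step of Gaussian elimination for each equation.
\<close>

lemma homogeneous_system_nontrivial_solution:
  fixes M :: "'p \<Rightarrow> 'i \<Rightarrow> real"
  assumes "finite P" "finite I" "card P < card I"
  shows "\<exists>c. (\<exists>i\<in>I. c i \<noteq> 0) \<and> (\<forall>p\<in>P. (\<Sum>i\<in>I. c i * M p i) = 0)"
  using assms
proof (induction P arbitrary: I M rule: finite_induct)
  case empty
  then have "I \<noteq> {}" by auto
  then show ?case by (intro exI[of _ "\<lambda>_. 1"]) auto
next
  case (insert p P)
  show ?case
  proof (cases "\<forall>i\<in>I. M p i = 0")
    case True
    have "card P < card I" using insert by simp
    from insert.IH[OF insert.prems(1) this, of M] obtain c
      where "\<exists>i\<in>I. c i \<noteq> 0" "\<forall>p\<in>P. (\<Sum>i\<in>I. c i * M p i) = 0" by blast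
    then show ?thesis using True by (intro exI[of _ c]) auto
  next
    case False
    then obtain j where j: "j \<in> I" "M p j \<noteq> 0" by blast
    have "card P < card (I - {j})" using insert j by simp
    from insert.IH[OF finite_Diff[OF insert.prems(1)] this, of "\<lambda>q i. M q i - M q j * M p i / M p j"]
    obtain c where c: "\<exists>i\<in>I - {j}. c i \<noteq> 0"
      and eq: "\<forall>q\<in>P. (\<Sum>i\<in>I - {j}. c i * (M q i - M q j * M p i / M p j)) = 0" by blast
    define s where "s = (\<Sum>i\<in>I - {j}. c i * M p i)"
    define c' where "c' = c(j := - s / M p j)"
    have expand: "(\<Sum>i\<in>I. c' i * M q i) = - s / M p j * M q j + (\<Sum>i\<in>I - {j}. c i * M q i)" for q
      using sum.remove[OF insert.prems(1) j(1), of "\<lambda>i. c' i * M q i"] by (simp add: c'_def)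
    have "(\<Sum>i\<in>I. c' i * M q i) = 0" if q: "q \<in> P" for q
    proof -
      have "0 = (\<Sum>i\<in>I - {j}. c i * (M q i - M q j * M p i / M p j))" using eq q by simp
      also have "\<dots> = (\<Sum>i\<in>I - {j}. c i * M q i - M q j / M p j * (c i * M p i))"
        by (intro sum.cong) (auto simp: algebra_simps)
      also have "\<dots> = (\<Sum>i\<in>I - {j}. c i * M q i) - M q j / M p j * s"
        by (simp add: sum_subtractf sum_distrib_left s_def)
      finally show ?thesis using expand[of q] by simp
    qed
    moreover have "(\<Sum>i\<in>I. c' i * M p i) = 0" using expand[of p] j by (simp add: s_def)
    moreover have "\<exists>i\<in>I. c' i \<noteq> 0" using c by (auto simp: c'_def)
    ultimately show ?thesis by (intro exI[of _ c']) auto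
  qed
qed

text \<open>
  The conditions on \<open>u\<close>, \<open>u'\<close> and \<open>f\<close> inside the definition
  of the eigenspace, as a relation between the three, so that the derivative and the vertex values
  can be added along with the functions.
\<close>

definition eigen_triple ::
  "('v, 'e) pre_digraph \<Rightarrow> ('e \<Rightarrow> real) \<Rightarrow> 'v set \<Rightarrow> real \<Rightarrow> ('e \<Rightarrow> real \<Rightarrow> real) \<Rightarrow> ('e \<Rightarrow> real \<Rightarrow> real)
    \<Rightarrow> ('v \<Rightarrow> real) \<Rightarrow> bool" where
  "eigen_triple G len D \<mu> u u' f \<longleftrightarrow>
    (\<forall>e\<in>arcs G. \<forall>x\<in>{0..len e}.
      (u e has_real_derivative u' e x) (at x within {0..len e}) \<and>
      (u' e has_real_derivative - \<mu> * u e x) (at x within {0..len e})) \<and>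
    (\<forall>e\<in>arcs G. u e 0 = f (tail G e) \<and> u e (len e) = f (head G e)) \<and>
    (\<forall>v\<in>verts G - D.
      (\<Sum>e\<in>out_arcs G v. u' e 0) + (\<Sum>e\<in>in_arcs G v. - u' e (len e)) = 0) \<and>
    (\<forall>v\<in>D. f v = 0)"

lemma eigenspace_iff:
  "u \<in> eigenspace G len D \<mu> \<longleftrightarrow>
    (\<forall>e x. e \<notin> arcs G \<or> x \<notin> {0..len e} \<longrightarrow> u e x = 0) \<and> (\<exists>u' f. eigen_triple G len D \<mu> u u' f)"
  by (simp add: eigenspace_def eigen_triple_def)

lemma eigen_triple_combination:
  assumes "eigen_triple G len D \<mu> u u' f" "eigen_triple G len D \<mu> v v' g"
  shows "eigen_triple G len D \<mu> (\<lambda>e x. u e x + c * v e x) (\<lambda>e x. u' e x + c * v' e x) (\<lambda>z. f z + c * g z)"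
  unfolding eigen_triple_def
proof (intro conjI ballI)
  fix e x assume ex: "e \<in> arcs G" "x \<in> {0..len e}"
  have "(u e has_real_derivative u' e x) (at x within {0..len e})"
    "(v e has_real_derivative v' e x) (at x within {0..len e})"
    "(u' e has_real_derivative - \<mu> * u e x) (at x within {0..len e})"
    "(v' e has_real_derivative - \<mu> * v e x) (at x within {0..len e})"
    using assms ex by (auto simp: eigen_triple_def)
  then show "((\<lambda>x. u e x + c * v e x) has_real_derivative u' e x + c * v' e x) (at x within {0..len e})"
    "((\<lambda>x. u' e x + c * v' e x) has_real_derivative - \<mu> * (u e x + c * v e x)) (at x within {0..len e})"
    by (auto intro!: derivative_eq_intros simp: algebra_simps)
next
  fix z assume z: "z \<in> verts G - D"
  have "(\<Sum>e\<in>out_arcs G z. u' e 0) + (\<Sum>e\<in>in_arcs G z. - u' e (len e)) = 0"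
    "(\<Sum>e\<in>out_arcs G z. v' e 0) + (\<Sum>e\<in>in_arcs G z. - v' e (len e)) = 0"
    using assms z by (auto simp: eigen_triple_def)
  then have "(\<Sum>e\<in>out_arcs G z. u' e 0) + (\<Sum>e\<in>in_arcs G z. - u' e (len e))
    + c * ((\<Sum>e\<in>out_arcs G z. v' e 0) + (\<Sum>e\<in>in_arcs G z. - v' e (len e))) = 0" by simp
  then show "(\<Sum>e\<in>out_arcs G z. u' e 0 + c * v' e 0) + (\<Sum>e\<in>in_arcs G z. - (u' e (len e) + c * v' e (len e))) = 0"
    by (simp add: sum.distrib sum_negf sum_subtractf algebra_simps flip: sum_distrib_left)
qed (use assms in \<open>auto simp: eigen_triple_def\<close>)

lemma eigen_triple_zero: "eigen_triple G len D \<mu> (\<lambda>e x. 0) (\<lambda>e x. 0) (\<lambda>z. 0)"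
  by (simp add: eigen_triple_def)

lemma subspace_eigenspace: "subspace (eigenspace G len D \<mu>)"
proof (rule subspaceI)
  show "0 \<in> eigenspace G len D \<mu>"
    using eigen_triple_zero by (fastforce simp: eigenspace_iff zero_fun_def)
next
  fix u v assume "u \<in> eigenspace G len D \<mu>" "v \<in> eigenspace G len D \<mu>"
  then obtain u' f v' g where uv: "eigen_triple G len D \<mu> u u' f" "eigen_triple G len D \<mu> v v' g"
    and off: "\<forall>e x. e \<notin> arcs G \<or> x \<notin> {0..len e} \<longrightarrow> u e x = 0" "\<forall>e x. e \<notin> arcs G \<or> x \<notin> {0..len e} \<longrightarrow> v e x = 0"
    by (auto simp: eigenspace_iff)
  have "u + v = (\<lambda>e x. u e x + 1 * v e x)" by (simp add: fun_eq_iff)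
  then show "u + v \<in> eigenspace G len D \<mu>"
    using eigen_triple_combination[OF uv, of 1] off unfolding eigenspace_iff by auto
next
  fix c u assume "u \<in> eigenspace G len D \<mu>"
  then obtain u' f where u: "eigen_triple G len D \<mu> u u' f"
    and off: "\<forall>e x. e \<notin> arcs G \<or> x \<notin> {0..len e} \<longrightarrow> u e x = 0"
    by (auto simp: eigenspace_iff)
  have "c *\<^sub>R u = (\<lambda>e x. 0 + c * u e x)" by (simp add: fun_eq_iff scaleR_fun_def)
  then show "c *\<^sub>R u \<in> eigenspace G len D \<mu>"
    using eigen_triple_combination[OF eigen_triple_zero u, of c] off unfolding eigenspace_iff by auto
qed

definition graph_inner ::
  "('v, 'e) pre_digraph \<Rightarrow> ('e \<Rightarrow> real) \<Rightarrow> ('e \<Rightarrow> real \<Rightarrow> real) \<Rightarrow> ('e \<Rightarrow> real \<Rightarrow> real) \<Rightarrow> real" where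
  "graph_inner G len u v = (\<Sum>e\<in>arcs G. integral {0..len e} (\<lambda>x. u e x * v e x))"

definition edge_continuous :: "('v, 'e) pre_digraph \<Rightarrow> ('e \<Rightarrow> real) \<Rightarrow> ('e \<Rightarrow> real \<Rightarrow> real) \<Rightarrow> bool" where
  "edge_continuous G len u \<longleftrightarrow> (\<forall>e\<in>arcs G. continuous_on {0..len e} (u e))"

lemma graph_inner_commute: "graph_inner G len u v = graph_inner G len v u"
  by (simp add: graph_inner_def mult.commute)

lemma graph_inner_sum_right:
  assumes "finite I" "edge_continuous G len u" "\<And>i. i \<in> I \<Longrightarrow> edge_continuous G len (v i)"
  shows "graph_inner G len u (\<lambda>e x. \<Sum>i\<in>I. v i e x) = (\<Sum>i\<in>I. graph_inner G len u (v i))"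
proof -
  have "integral {0..len e} (\<lambda>x. u e x * (\<Sum>i\<in>I. v i e x)) = (\<Sum>i\<in>I. integral {0..len e} (\<lambda>x. u e x * v i e x))"
    if "e \<in> arcs G" for e
    unfolding sum_distrib_left
    by (rule integral_sum[OF assms(1)])
      (use assms that in \<open>auto simp: edge_continuous_def intro!: integrable_continuous_real continuous_intros\<close>)
  then show ?thesis unfolding graph_inner_def by (simp add: sum.swap[of _ I])
qed

lemma eigen_triple_regular:
  assumes "eigen_triple G len D \<mu> u u' f"
  shows "c1_on_graph G len u u' f" "edge_continuous G len u" "edge_continuous G len u'"
proof -
  have c: "continuous_on {0..len e} (u e)" "continuous_on {0..len e} (u' e)" if "e \<in> arcs G" for e
    using assms that
    by (auto simp: eigen_triple_def intro: DERIV_continuous_on[of _ _ "u' e"]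
        DERIV_continuous_on[of _ _ "\<lambda>x. - (\<mu> * u e x)"])
  then show "edge_continuous G len u" "edge_continuous G len u'" by (auto simp: edge_continuous_def)
  show "c1_on_graph G len u u' f" using assms c by (auto simp: eigen_triple_def c1_on_graph_def c1_on_def)
qed

context quantum_graph
begin

text \<open>
  Integration by parts on each edge. The boundary terms, grouped by vertices, cancel by the
  balance of the derivatives of \<open>v\<close> and by the vanishing of \<open>u\<close> on
  \<open>D\<close>.
\<close>

lemma Green_identity:
  assumes v: "eigen_triple G len D \<mu> v v' g" and u: "c1_on_graph G len u u' f" and f: "\<forall>z\<in>D. f z = 0"
  shows "graph_inner G len u' v' = \<mu> * graph_inner G len u v"
proof -
  have edge: "integral {0..len e} (\<lambda>x. u' e x * v' e x)
      = \<mu> * integral {0..len e} (\<lambda>x. u e x * v e x) + (f (head G e) * v' e (len e) - f (tail G e) * v' e 0)"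
    if e: "e \<in> arcs G" for e
  proof -
    have ue: "c1_on 0 (len e) (u e) (u' e)" "u e 0 = f (tail G e)" "u e (len e) = f (head G e)"
      using u e by (auto simp: c1_on_graph_def)
    have dv: "(v e has_real_derivative v' e x) (at x within {0..len e})"
      "(v' e has_real_derivative - \<mu> * v e x) (at x within {0..len e})" if "x \<in> {0..len e}" for x
      using v e that by (auto simp: eigen_triple_def)
    have du: "(u e has_real_derivative u' e x) (at x within {0..len e})" if "x \<in> {0..len e}" for x
      using ue(1) that by (auto simp: c1_on_def)
    have "((\<lambda>x. u e x * v' e x) has_real_derivative u' e x * v' e x - \<mu> * (u e x * v e x)) (at x within {0..len e})"
      if "x \<in> {0..len e}" for x
      using DERIV_mult[OF du[OF that] dv(2)[OF that]] by (simp add: algebra_simps)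
    then have I: "((\<lambda>x. u' e x * v' e x - \<mu> * (u e x * v e x)) has_integral
        (u e (len e) * v' e (len e) - u e 0 * v' e 0)) {0..len e}"
      using len_pos[OF e]
      by (intro fundamental_theorem_of_calculus) (auto simp flip: has_real_derivative_iff_has_vector_derivative)
    have cont: "continuous_on {0..len e} (u e)" "continuous_on {0..len e} (u' e)"
      "continuous_on {0..len e} (v e)" "continuous_on {0..len e} (v' e)"
      using c1_on_continuous[OF ue(1)] ue(1) eigen_triple_regular[OF v] e
      by (auto simp: c1_on_def edge_continuous_def)
    have "integral {0..len e} (\<lambda>x. u' e x * v' e x - \<mu> * (u e x * v e x))
      = integral {0..len e} (\<lambda>x. u' e x * v' e x) - \<mu> * integral {0..len e} (\<lambda>x. u e x * v e x)"
      using cont by (subst Henstock_Kurzweil_Integration.integral_diff)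
        (auto intro!: integrable_continuous_real continuous_intros)
    then show ?thesis using integral_unique[OF I] ue by simp
  qed
  have heads: "(\<Sum>e\<in>arcs G. f (head G e) * v' e (len e)) = (\<Sum>z\<in>verts G. f z * (\<Sum>e\<in>in_arcs G z. v' e (len e)))"
  proof -
    have "(\<Sum>e\<in>arcs G. f (head G e) * v' e (len e))
        = (\<Sum>z\<in>verts G. \<Sum>e\<in>{e \<in> arcs G. head G e = z}. f (head G e) * v' e (len e))"
      by (rule sum.group[symmetric]) auto
    also have "\<dots> = (\<Sum>z\<in>verts G. f z * (\<Sum>e\<in>in_arcs G z. v' e (len e)))"
      unfolding in_arcs_def sum_distrib_left by (intro sum.cong) auto
    finally show ?thesis .
  qed
  have tails: "(\<Sum>e\<in>arcs G. f (tail G e) * v' e 0) = (\<Sum>z\<in>verts G. f z * (\<Sum>e\<in>out_arcs G z. v' e 0))"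
  proof -
    have "(\<Sum>e\<in>arcs G. f (tail G e) * v' e 0)
        = (\<Sum>z\<in>verts G. \<Sum>e\<in>{e \<in> arcs G. tail G e = z}. f (tail G e) * v' e 0)"
      by (rule sum.group[symmetric]) auto
    also have "\<dots> = (\<Sum>z\<in>verts G. f z * (\<Sum>e\<in>out_arcs G z. v' e 0))"
      unfolding out_arcs_def sum_distrib_left by (intro sum.cong) auto
    finally show ?thesis .
  qed
  have "f z * (\<Sum>e\<in>in_arcs G z. v' e (len e)) = f z * (\<Sum>e\<in>out_arcs G z. v' e 0)" if "z \<in> verts G" for z
    using f v that by (cases "z \<in> D") (auto simp: eigen_triple_def sum_negf)
  then have "(\<Sum>e\<in>arcs G. f (head G e) * v' e (len e)) = (\<Sum>e\<in>arcs G. f (tail G e) * v' e 0)"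
    unfolding heads tails by (intro sum.cong) auto
  then show ?thesis
    unfolding graph_inner_def using edge by (simp add: sum.distrib sum_subtractf sum_distrib_left)
qed

lemma eigenfunctions_orthogonal:
  assumes "eigen_triple G len D \<mu> u u' f" "eigen_triple G len D \<nu> v v' g" "\<mu> \<noteq> \<nu>"
  shows "graph_inner G len u v = 0"
proof -
  have "\<nu> * graph_inner G len u v = graph_inner G len u' v'"
    using Green_identity[OF assms(2) eigen_triple_regular(1)[OF assms(1)]] assms(1)
    by (simp add: eigen_triple_def)
  also have "\<dots> = \<mu> * graph_inner G len u v"
    using Green_identity[OF assms(1) eigen_triple_regular(1)[OF assms(2)]] assms(2)
    by (simp add: eigen_triple_def graph_inner_commute)
  finally show ?thesis using assms(3) by simp
qed

lemma graph_inner_pos: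
  assumes "u \<in> eigenspace G len D \<mu>" "u \<noteq> 0"
  shows "graph_inner G len u u > 0"
proof -
  obtain u' f where t: "eigen_triple G len D \<mu> u u' f"
    and off: "\<forall>e x. e \<notin> arcs G \<or> x \<notin> {0..len e} \<longrightarrow> u e x = 0"
    using assms(1) by (auto simp: eigenspace_iff)
  obtain e0 x0 where ne: "u e0 x0 \<noteq> 0" using assms(2) by (auto simp: fun_eq_iff)
  then have e0: "e0 \<in> arcs G" "x0 \<in> {0..len e0}" using off by blast+
  have cont: "continuous_on {0..len e} (\<lambda>x. u e x * u e x)" if "e \<in> arcs G" for e
    using eigen_triple_regular(2)[OF t] that by (auto simp: edge_continuous_def intro!: continuous_intros)
  have nonneg: "integral {0..len e} (\<lambda>x. u e x * u e x) \<ge> 0" if "e \<in> arcs G" for e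
    using cont[OF that] by (intro integral_nonneg integrable_continuous_real) auto
  have "integral {0..len e0} (\<lambda>x. u e0 x * u e0 x) \<noteq> 0"
  proof
    assume "integral {0..len e0} (\<lambda>x. u e0 x * u e0 x) = 0"
    then have "((\<lambda>x. u e0 x * u e0 x) has_integral 0) (cbox 0 (len e0))"
      using integrable_integral[OF integrable_continuous_real[OF cont[OF e0(1)]]] by simp
    then have "u e0 x0 * u e0 x0 = 0"
      using cont[OF e0(1)] e0(2) by (intro has_integral_0_cbox_imp_0[of 0 "len e0" "\<lambda>x. u e0 x * u e0 x"])
        (use len_pos[OF e0(1)] in auto)
    then show False using ne by simp
  qed
  then have "integral {0..len e0} (\<lambda>x. u e0 x * u e0 x) > 0" using nonneg[OF e0(1)] by linarith
  then show ?thesis unfolding graph_inner_def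
    using nonneg e0(1) by (intro sum_pos2[of _ e0]) auto
qed

text \<open>
  Eigenfunctions of different eigenvalues are orthogonal both in \<open>L\<^sup>2\<close> and, by
  Green's identity, with respect to their derivatives, so there are no mixed terms.
\<close>

lemma energy_of_eigenfunction_sum:
  assumes fin: "finite M" and t: "\<And>\<mu>. \<mu> \<in> M \<Longrightarrow> eigen_triple G len D \<mu> (u \<mu>) (u' \<mu>) (f \<mu>)"
  defines "U \<equiv> \<lambda>e x. \<Sum>\<mu>\<in>M. u \<mu> e x" and "U' \<equiv> \<lambda>e x. \<Sum>\<mu>\<in>M. u' \<mu> e x" and "F \<equiv> \<lambda>z. \<Sum>\<mu>\<in>M. f \<mu> z"
  shows "c1_on_graph G len U U' F" "\<forall>z\<in>D. F z = 0"
    "(\<Sum>e\<in>arcs G. energy \<omega> 0 (len e) (U e) (U' e)) = (\<Sum>\<mu>\<in>M. (\<mu> - \<omega>\<^sup>2) * graph_inner G len (u \<mu>) (u \<mu>))"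
proof -
  note reg = eigen_triple_regular[OF t]
  show sob: "c1_on_graph G len U U' F"
    unfolding c1_on_graph_def
  proof (intro ballI conjI)
    fix e assume e: "e \<in> arcs G"
    have s: "c1_on 0 (len e) (u \<mu> e) (u' \<mu> e)" "u \<mu> e 0 = f \<mu> (tail G e)" "u \<mu> e (len e) = f \<mu> (head G e)"
      if "\<mu> \<in> M" for \<mu>
      using reg(1)[OF that] e by (auto simp: c1_on_graph_def)
    show "c1_on 0 (len e) (U e) (U' e)"
      unfolding c1_on_def U_def U'_def using s(1)
      by (auto simp: c1_on_def intro!: DERIV_sum continuous_intros)
    show "U e 0 = F (tail G e)" "U e (len e) = F (head G e)"
      unfolding U_def F_def using s by auto
  qed
  show F: "\<forall>z\<in>D. F z = 0" unfolding F_def using t by (auto simp: eigen_triple_def)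
  have cU: "edge_continuous G len U" "edge_continuous G len U'"
    using sob c1_on_continuous by (auto simp: c1_on_graph_def edge_continuous_def c1_on_def)
  have proj: "graph_inner G len U (u \<mu>) = graph_inner G len (u \<mu>) (u \<mu>)" if \<mu>: "\<mu> \<in> M" for \<mu>
  proof -
    have "graph_inner G len U (u \<mu>) = graph_inner G len (u \<mu>) U" by (rule graph_inner_commute)
    also have "\<dots> = (\<Sum>\<nu>\<in>M. graph_inner G len (u \<mu>) (u \<nu>))"
      unfolding U_def using reg(2) \<mu> by (intro graph_inner_sum_right fin) auto
    also have "\<dots> = (\<Sum>\<nu>\<in>M. if \<nu> = \<mu> then graph_inner G len (u \<mu>) (u \<mu>) else 0)"
      using eigenfunctions_orthogonal[OF t[OF \<mu>] t] by (intro sum.cong) auto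
    finally show ?thesis using fin \<mu> by simp
  qed
  have "graph_inner G len U U = (\<Sum>\<mu>\<in>M. graph_inner G len U (u \<mu>))"
    using graph_inner_sum_right[OF fin cU(1), of u] reg(2) by (simp add: U_def)
  then have UU: "graph_inner G len U U = (\<Sum>\<mu>\<in>M. graph_inner G len (u \<mu>) (u \<mu>))"
    using proj by simp
  have "graph_inner G len U' U' = (\<Sum>\<mu>\<in>M. graph_inner G len U' (u' \<mu>))"
    using graph_inner_sum_right[OF fin cU(2), of u'] reg(3) by (simp add: U'_def)
  then have UU': "graph_inner G len U' U' = (\<Sum>\<mu>\<in>M. \<mu> * graph_inner G len (u \<mu>) (u \<mu>))"
    using Green_identity[OF t sob F] proj by simp
  have "energy \<omega> 0 (len e) (U e) (U' e)
      = integral {0..len e} (\<lambda>x. U' e x * U' e x) - \<omega>\<^sup>2 * integral {0..len e} (\<lambda>x. U e x * U e x)"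
    if "e \<in> arcs G" for e
  proof -
    have "continuous_on {0..len e} (U e)" "continuous_on {0..len e} (U' e)"
      using cU that by (auto simp: edge_continuous_def)
    then show ?thesis unfolding energy_def power2_eq_square[of "U e _"] power2_eq_square[of "U' e _"]
      by (subst Henstock_Kurzweil_Integration.integral_diff)
        (auto intro!: integrable_continuous_real continuous_intros)
  qed
  then have "(\<Sum>e\<in>arcs G. energy \<omega> 0 (len e) (U e) (U' e)) = graph_inner G len U' U' - \<omega>\<^sup>2 * graph_inner G len U U"
    by (simp add: graph_inner_def sum_subtractf sum_distrib_left)
  then show "(\<Sum>e\<in>arcs G. energy \<omega> 0 (len e) (U e) (U' e)) = (\<Sum>\<mu>\<in>M. (\<mu> - \<omega>\<^sup>2) * graph_inner G len (u \<mu>) (u \<mu>))"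
    by (simp add: UU UU' sum_subtractf sum_distrib_left left_diff_distrib)
qed

text \<open>
  Bases of the eigenspaces of \<open>lam 1, \<dots>, lam k\<close> have together at least
  \<open>k\<close> elements, more than there are points in \<open>P\<close>. A nontrivial
  combination of them vanishing on \<open>P\<close> has negative energy if all these eigenvalues
  are less than \<open>\<omega>\<^sup>2\<close>. A combination is handled through its coefficients
  and its components in the single eigenspaces; one of these components is not zero, and by
  orthogonality that is enough.
\<close>

lemma eigenvalue_lower_bound:
  assumes num: "eigenvalue_numbering G len D lam" and k: "1 \<le> k"
    and P: "finite P" "card P < k"
    and ctrl: "\<And>u u' f. c1_on_graph G len u u' f \<Longrightarrow> \<forall>(e, x)\<in>P. u e x = 0 \<Longrightarrow> \<forall>z\<in>D. f z = 0 \<Longrightarrow>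
      0 \<le> (\<Sum>e\<in>arcs G. energy \<omega> 0 (len e) (u e) (u' e))"
  shows "\<omega>\<^sup>2 \<le> lam k"
proof (rule ccontr)
  assume "\<not> ?thesis"
  then have less: "lam k < \<omega>\<^sup>2" by simp
  define M where "M = lam ` {1..k}"
  have finM: "finite M" by (simp add: M_def)
  have M_less: "\<mu> < \<omega>\<^sup>2" if \<mu>: "\<mu> \<in> M" for \<mu>
  proof -
    obtain i where i: "1 \<le> i" "i \<le> k" "\<mu> = lam i" using \<mu> by (auto simp: M_def)
    have "mono_on {1..} lam" using num by (simp add: eigenvalue_numbering_def)
    then have "lam i \<le> lam k" using i k by (auto simp: mono_on_def)
    then show ?thesis using i less by simp
  qed
  have "\<exists>B. B \<subseteq> eigenspace G len D \<mu> \<and> independent B \<and> card B = dim (eigenspace G len D \<mu>)" for \<mu>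
    using basis_exists by metis
  then obtain B where B: "\<And>\<mu>. B \<mu> \<subseteq> eigenspace G len D \<mu>" "\<And>\<mu>. independent (B \<mu>)"
    "\<And>\<mu>. card (B \<mu>) = dim (eigenspace G len D \<mu>)" by metis
  have fib: "finite {j. 1 \<le> j \<and> lam j = \<mu>}" "card {j. 1 \<le> j \<and> lam j = \<mu>} = card (B \<mu>)" for \<mu>
    using num B(3) by (auto simp: eigenvalue_numbering_def)
  have finB: "finite (B \<mu>)" if "\<mu> \<in> M" for \<mu>
  proof -
    have "{j. 1 \<le> j \<and> lam j = \<mu>} \<noteq> {}" using that by (auto simp: M_def)
    then have "card (B \<mu>) > 0" using fib[of \<mu>] by (metis card_gt_0_iff)
    then show ?thesis using card_gt_0_iff by blast
  qed
  define I where "I = Sigma M B"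
  have finI: "finite I" unfolding I_def using finM finB by (intro finite_SigmaI)
  have "k = (\<Sum>\<mu>\<in>M. card {j \<in> {1..k}. lam j = \<mu>})"
    using sum.group[of "{1..k}" M lam "\<lambda>_. 1 :: nat"] finM by (simp add: M_def)
  also have "\<dots> \<le> (\<Sum>\<mu>\<in>M. card (B \<mu>))"
    unfolding fib(2)[symmetric] by (intro sum_mono card_mono fib(1)) auto
  also have "\<dots> = card I" unfolding I_def using finM finB by simp
  finally have "card P < card I" using P by simp
  then obtain c where c: "\<exists>i\<in>I. c i \<noteq> 0"
    and zero: "\<forall>p\<in>P. (\<Sum>i\<in>I. c i * snd i (fst p) (snd p)) = 0"
    using homogeneous_system_nontrivial_solution[OF P(1) finI, of "\<lambda>p i. snd i (fst p) (snd p)"] by blast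
  define u where "u \<mu> = (\<Sum>b\<in>B \<mu>. c (\<mu>, b) *\<^sub>R b)" for \<mu>
  have u_in: "u \<mu> \<in> eigenspace G len D \<mu>" for \<mu>
    unfolding u_def using B(1) by (intro subspace_sum subspace_scale subspace_eigenspace) auto
  then have "\<exists>u' f. eigen_triple G len D \<mu> (u \<mu>) u' f" for \<mu> by (simp add: eigenspace_iff)
  then obtain u' f where t: "\<And>\<mu>. eigen_triple G len D \<mu> (u \<mu>) (u' \<mu>) (f \<mu>)" by metis
  note E = energy_of_eigenfunction_sum[OF finM t]
  have "(\<Sum>\<mu>\<in>M. u \<mu> e x) = 0" if p: "(e, x) \<in> P" for e x
  proof -
    have "(\<Sum>\<mu>\<in>M. u \<mu> e x) = (\<Sum>\<mu>\<in>M. \<Sum>b\<in>B \<mu>. c (\<mu>, b) * b e x)"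
      by (simp add: u_def sum_fun_apply scaleR_fun_def)
    also have "\<dots> = (\<Sum>i\<in>I. c i * snd i e x)"
      unfolding I_def using finM finB by (subst sum.Sigma) (auto simp: case_prod_beta)
    finally show ?thesis using zero p by fastforce
  qed
  then have "0 \<le> (\<Sum>\<mu>\<in>M. (\<mu> - \<omega>\<^sup>2) * graph_inner G len (u \<mu>) (u \<mu>))"
    using ctrl[OF E(1) _ E(2)] E(3)[of \<omega>] by auto
  moreover have "(\<Sum>\<mu>\<in>M. (\<mu> - \<omega>\<^sup>2) * graph_inner G len (u \<mu>) (u \<mu>)) < 0"
  proof -
    have nonneg: "0 \<le> graph_inner G len (u \<mu>) (u \<mu>)" for \<mu>
      using graph_inner_pos[OF u_in[of \<mu>]] by (cases "u \<mu> = 0") (auto simp: graph_inner_def)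
    obtain \<mu>0 b0 where b0: "\<mu>0 \<in> M" "b0 \<in> B \<mu>0" "c (\<mu>0, b0) \<noteq> 0" using c by (auto simp: I_def)
    have "u \<mu>0 \<noteq> 0"
    proof
      assume "u \<mu>0 = 0"
      then have "c (\<mu>0, b0) = 0"
        using independentD[OF B(2) finB[OF b0(1)] order.refl _ b0(2), of "\<lambda>b. c (\<mu>0, b)"] by (simp add: u_def)
      then show False using b0 by simp
    qed
    then have "0 < graph_inner G len (u \<mu>0) (u \<mu>0)" by (rule graph_inner_pos[OF u_in])
    then have "0 < (\<omega>\<^sup>2 - \<mu>0) * graph_inner G len (u \<mu>0) (u \<mu>0)" using M_less[OF b0(1)] by simp
    moreover have "0 \<le> (\<omega>\<^sup>2 - \<mu>) * graph_inner G len (u \<mu>) (u \<mu>)" if "\<mu> \<in> M" for \<mu>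
      using M_less[OF that] nonneg by simp
    ultimately have "0 < (\<Sum>\<mu>\<in>M. (\<omega>\<^sup>2 - \<mu>) * graph_inner G len (u \<mu>) (u \<mu>))"
      using finM b0(1) by (intro sum_pos2[of _ \<mu>0]) auto
    also have "\<dots> = - (\<Sum>\<mu>\<in>M. (\<mu> - \<omega>\<^sup>2) * graph_inner G len (u \<mu>) (u \<mu>))"
      unfolding sum_negf[symmetric] by (intro sum.cong) (auto simp: algebra_simps)
    finally show ?thesis by simp
  qed
  ultimately show False by simp
qed

end

theorem theorem4p7:
  fixes G :: "('v, 'e) pre_digraph" and len :: "'e \<Rightarrow> real" and D :: "'v set"
    and lam :: "nat \<Rightarrow> real" and k :: nat
  assumes "quantum_graph G len D"
    and "\<not> cycle_graph G"
    and "eigenvalue_numbering G len D lam"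
    and "k \<ge> 2 \<or> (D \<noteq> {} \<and> k \<ge> 1)"
  shows "lam k \<ge>
    (if int k \<ge> int (card (Neumann_vertices G D)) + betti G
     then (real k - (real (card (Neumann_vertices G D)) + real_of_int (betti G)) / 2)\<^sup>2
          * pi\<^sup>2 / (total_length G len)\<^sup>2
     else (real k)\<^sup>2 * pi\<^sup>2 / (4 * (total_length G len)\<^sup>2))"
proof -
  interpret quantum_graph G len D by fact
  define N where "N = Neumann_vertices G D"
  define L where "L = total_length G len"
  have k1: "1 \<le> k" using assms(4) by auto
  have Lpos: "L > 0"
    unfolding L_def total_length_def using len_pos arcs_nonempty by (intro sum_pos) auto
  have DV: "D \<subseteq> verts G" and Ddeg: "\<And>v. v \<in> D \<Longrightarrow> degree G v = 1" using Dirichlet_leaves by auto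
  have N_sub: "N \<subseteq> verts G" and ND: "N \<inter> D = {}" by (auto simp: N_def Neumann_vertices_def)
  have main: "\<omega>\<^sup>2 \<le> lam k"
    if \<omega>: "\<omega> > 0" and T: "T = pi \<and> \<kappa> = pi / 2 \<or> T = pi / 2 \<and> \<kappa> = 0"
      and budget: "\<omega> * L + (real (card N) + real_of_int (betti G)) * \<kappa> \<le> real k * T" for \<omega> T \<kappa>
  proof -
    \<comment> \<open>The initial loads: \<open>(True, 0)\<close> on \<open>D\<close>, and \<open>(True, \<pi> / 2)\<close> on \<open>N\<close> if \<open>T = \<pi>\<close>. All their angles are
      \<open>0\<close> or \<open>\<pi> / 2\<close>, so that the form of the initial state is the energy alone.\<close>
    define d where "d v \<longleftrightarrow> v \<in> D \<or> T = pi \<and> v \<in> N" for v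
    define a where "a v = (if v \<in> N then \<kappa> else 0)" for v
    have Tpos: "T > 0" "\<kappa> \<ge> 0" "\<kappa> < T" using T pi_gt_zero by linarith+
    have no_cot: "cot (load_angle (d v) (a v)) = 0" for v
    proof -
      have "load_angle (d v) (a v) = 0 \<or> load_angle (d v) (a v) = pi / 2"
        using T pi_gt_zero ND by (auto simp: load_angle_def d_def a_def)
      then show ?thesis by (elim disjE) (simp_all only: cot_def cos_pi_half sin_zero div_0 div_by_0)
    qed
    have sum_a: "(\<Sum>v\<in>verts G. a v) = real (card N) * \<kappa>"
      using N_sub by (simp add: a_def sum.If_cases Int_absorb1)
    have "\<exists>P. finite P \<and> P \<subseteq> Sigma (arcs G) (\<lambda>e. {0..len e}) \<and> int (card P) < int k \<and>
        controlled G len \<omega> (arcs G) (verts G) d a P"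
    proof (rule exists_controlling_points[OF \<omega> T subset_refl arcs_nonempty subset_refl cut_connected_graph])
      show "0 \<le> a v \<and> a v < T \<and> (d v \<or> T = pi / 2 \<or> a v = 0)" for v
        using Tpos T by (auto simp: a_def d_def)
      show "d v \<or> T = pi / 2" if "v \<in> verts G" "subdegree G (arcs G) v = 1" for v
        using T that by (auto simp: d_def N_def Neumann_vertices_def subdegree_arcs)
      show "T = pi / 2 \<or> (\<exists>v\<in>verts G. d v \<or> 3 \<le> subdegree G (arcs G) v)"
      proof (cases "T = pi / 2")
        case False
        then have Tpi: "T = pi" using T by blast
        obtain v where v: "v \<in> verts G" "degree G v \<noteq> 2" using assms(2) by (auto simp: cycle_graph_def)
        have "degree G v > 0"
          using cut_connected_subdegree_pos[OF cut_connected_graph v(1) finite_arcs arcs_nonempty]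
          by (simp add: subdegree_arcs)
        then have "degree G v = 1 \<or> 3 \<le> degree G v" using v(2) by linarith
        then show ?thesis using v(1) Tpi by (auto simp: d_def N_def Neumann_vertices_def subdegree_arcs)
      qed simp
      show "T = pi \<or> 2 \<le> int k \<or> (\<exists>v\<in>verts G. d v)"
        using assms(4) DV by (auto simp: d_def)
      have "real (card (arcs G)) - real (card (verts G)) + 1 = real_of_int (betti G)"
        by (simp add: betti_def)
      then show "\<omega> * (\<Sum>e\<in>arcs G. len e) + (\<Sum>v\<in>verts G. a v)
          + (real (card (arcs G)) - real (card (verts G)) + 1) * \<kappa> \<le> real_of_int (int k) * T"
        using budget unfolding sum_a L_def total_length_def by (simp add: algebra_simps)
    qed
    then obtain P where P: "finite P" "card P < k" "controlled G len \<omega> (arcs G) (verts G) d a P" by auto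
    show ?thesis
    proof (rule eigenvalue_lower_bound[OF assms(3) k1 P(1,2)])
      fix u u' f
      assume u: "c1_on_graph G len u u' f" "\<forall>(e, x)\<in>P. u e x = 0" "\<forall>z\<in>D. f z = 0"
      have "\<forall>v\<in>verts G. d v \<and> a v = 0 \<longrightarrow> f v = 0"
        using u(3) T pi_gt_zero by (auto simp: d_def a_def)
      then have "0 \<le> (\<Sum>e\<in>arcs G. energy \<omega> 0 (len e) (u e) (u' e))
          + (\<Sum>v\<in>verts G. \<omega> * cot (load_angle (d v) (a v)) * (f v)\<^sup>2)"
        using P(3) u(1,2) unfolding controlled_def by blast
      then show "0 \<le> (\<Sum>e\<in>arcs G. energy \<omega> 0 (len e) (u e) (u' e))" by (simp add: no_cot)
    qed
  qed
  show ?thesis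
  proof (cases "int k \<ge> int (card N) + betti G")
    case True
    define x where "x = real (card N) + real_of_int (betti G)"
    have "x \<le> real k" using True unfolding x_def by linarith
    then have pos: "real k - x / 2 > 0" using k1 by (cases "x > 0") auto
    \<comment> \<open>Here \<open>\<omega>\<close> is chosen such that the total angle \<open>\<omega> L + x \<pi> / 2\<close> is exactly \<open>k \<pi>\<close>.\<close>
    have "((real k - x / 2) * pi / L)\<^sup>2 \<le> lam k"
    proof (rule main[of _ pi "pi / 2"])
      show "0 < (real k - x / 2) * pi / L" using pos Lpos by simp
      show "(real k - x / 2) * pi / L * L + (real (card N) + real_of_int (betti G)) * (pi / 2) \<le> real k * pi"
        unfolding x_def[symmetric] using Lpos by (simp add: field_simps)
    qed simp
    then show ?thesis using True by (simp add: N_def L_def x_def power_divide power_mult_distrib)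
  next
    case False
    \<comment> \<open>Here \<open>\<omega> L = k \<pi> / 2\<close>.\<close>
    have "(real k * pi / (2 * L))\<^sup>2 \<le> lam k"
      by (rule main[of _ "pi / 2" 0]) (use k1 Lpos in \<open>auto simp: field_simps\<close>)
    then show ?thesis using False by (simp add: N_def L_def power_divide power_mult_distrib)
  qed
qed

end
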